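(* Let $\Omega_1,\Omega_2\subseteq\mathbb{C}$ be open. Let $f:\Omega_2\to\mathbb{C}$ be holomorphic, and suppose $g:\Omega_1\to\mathbb{C}$ is equal to $\frac{\partial G}{\partial\bar z}$ for some $G\in\mathcal{C}^r(\Omega_1)$, $r=0,1,2,\ldots,\infty,\omega$. For a continuous function $v:\Omega_1\to\Omega_2$, define the open set $\Omega_0=\{z\in\Omega_1:f(v(z))\ne0\}$. If $v$ satisfies condition $( * )$ on $\Omega_0$ (the partial derivatives $v_x$, $v_y$ exist at every point of $\Omega_0$ except for countably many) and $\frac{\partial v}{\partial\bar z}=f(v)g(z)$ almost everywhere in $\Omega_0$, then $v\in\mathcal{C}^r(\Omega_0)$.
   Context: Write $z=x+iy$. For a complex valued function $v$ on an open subset of $\mathbb{C}=\mathbb{R}^2$, $v_x,v_y$ denote the pointwise classical partial derivatives, and at points where both exist, $\frac{\partial v}{\partial\bar z}=\frac12(v_x+iv_y)$; this is the pointwise, not the distributional, derivative. That $g$ equals $\frac{\partial G}{\partial\bar z}$ on $\Omega_1$ includes the assertion that the partial derivatives $G_x$, $G_y$ exist at every point of $\Omega_1$. $\mathcal{C}^r$ is in the sense of real variables (continuous for $r=0$, $r$ times continuously differentiable for $r=1,2,\ldots$, smooth for $r=\infty$, real analytic for $r=\omega$). *)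

theory Defs
  imports "HOL-Analysis.Analysis"
begin

text \<open>Classical (pointwise) partial derivatives with respect to \<open>x = Re z\<close> and \<open>y = Im z\<close>.
  The values \<open>dx v z\<close>, \<open>dy v z\<close>, \<open>dbar v z\<close> are meaningful only where \<open>partials_exist v z\<close> holds.\<close>

definition has_dx :: "(complex \<Rightarrow> complex) \<Rightarrow> complex \<Rightarrow> complex \<Rightarrow> bool" where
  "has_dx v d z \<longleftrightarrow> ((\<lambda>t. v (Complex t (Im z))) has_vector_derivative d) (at (Re z))"

definition has_dy :: "(complex \<Rightarrow> complex) \<Rightarrow> complex \<Rightarrow> complex \<Rightarrow> bool" where
  "has_dy v d z \<longleftrightarrow> ((\<lambda>t. v (Complex (Re z) t)) has_vector_derivative d) (at (Im z))"

definition partials_exist :: "(complex \<Rightarrow> complex) \<Rightarrow> complex \<Rightarrow> bool" where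
  "partials_exist v z \<longleftrightarrow> (\<exists>d. has_dx v d z) \<and> (\<exists>d. has_dy v d z)"

definition dx :: "(complex \<Rightarrow> complex) \<Rightarrow> complex \<Rightarrow> complex" where
  "dx v z = (THE d. has_dx v d z)"

definition dy :: "(complex \<Rightarrow> complex) \<Rightarrow> complex \<Rightarrow> complex" where
  "dy v z = (THE d. has_dy v d z)"

definition dbar :: "(complex \<Rightarrow> complex) \<Rightarrow> complex \<Rightarrow> complex" where
  "dbar v z = (dx v z + \<i> * dy v z) / 2"

text \<open>The classes \<open>\<C>\<^sup>r(S)\<close> in the sense of real variables, for open \<open>S\<close>.
  For finite \<open>r\<close>: all iterated partial derivatives of order at most \<open>r\<close> exist and are
  continuous on \<open>S\<close>.\<close>

primrec Ck_on :: "nat \<Rightarrow> complex set \<Rightarrow> (complex \<Rightarrow> complex) \<Rightarrow> bool" where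
  "Ck_on 0 S v \<longleftrightarrow> continuous_on S v"
| "Ck_on (Suc k) S v \<longleftrightarrow>
     continuous_on S v \<and> (\<forall>z\<in>S. partials_exist v z) \<and> Ck_on k S (dx v) \<and> Ck_on k S (dy v)"

text \<open>Locally a convergent power series in the two real variables \<open>x - x\<^sub>0\<close> and \<open>y - y\<^sub>0\<close>,
  with complex coefficients.\<close>

definition real_analytic_on2 :: "complex set \<Rightarrow> (complex \<Rightarrow> complex) \<Rightarrow> bool" where
  "real_analytic_on2 S v \<longleftrightarrow>
     (\<forall>z0\<in>S. \<exists>\<epsilon>>0. \<exists>a :: nat \<times> nat \<Rightarrow> complex. \<forall>z\<in>ball z0 \<epsilon>.
        ((\<lambda>(m, n). a (m, n) * of_real (Re z - Re z0) ^ m * of_real (Im z - Im z0) ^ n)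
           has_sum v z) UNIV)"

datatype regularity = Finite_Order nat | Smooth | Real_Analytic

fun Cr_on :: "regularity \<Rightarrow> complex set \<Rightarrow> (complex \<Rightarrow> complex) \<Rightarrow> bool" where
  "Cr_on (Finite_Order k) S v \<longleftrightarrow> Ck_on k S v"
| "Cr_on Smooth S v \<longleftrightarrow> (\<forall>k. Ck_on k S v)"
| "Cr_on Real_Analytic S v \<longleftrightarrow> real_analytic_on2 S v"

text \<open>Condition \<open>(*)\<close>.\<close>

definition partials_exist_but_countable :: "(complex \<Rightarrow> complex) \<Rightarrow> complex set \<Rightarrow> bool" where
  "partials_exist_but_countable v S \<longleftrightarrow> countable {z\<in>S. \<not> partials_exist v z}"

lemma has_dx_imp_dx: "has_dx v d z \<Longrightarrow> dx v z = d"
  unfolding dx_def has_dx_def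
  by (rule the_equality) (auto intro: vector_derivative_unique_at)

lemma has_dy_imp_dy: "has_dy v d z \<Longrightarrow> dy v z = d"
  unfolding dy_def has_dy_def
  by (rule the_equality) (auto intro: vector_derivative_unique_at)

lemma open_nonvanishing_set:
  assumes "open \<Omega>1" "open \<Omega>2" "f holomorphic_on \<Omega>2" "continuous_on \<Omega>1 v" "v ` \<Omega>1 \<subseteq> \<Omega>2"
  shows "open {z\<in>\<Omega>1. f (v z) \<noteq> 0}"
proof -
  have "continuous_on \<Omega>1 (\<lambda>z. f (v z))"
    using assms by (auto intro: continuous_on_compose2 holomorphic_on_imp_continuous_on)
  then have "open (\<Omega>1 \<inter> (\<lambda>z. f (v z)) -` (- {0}))"
    using assms(1) by (intro continuous_open_preimage) auto
  moreover have "\<Omega>1 \<inter> (\<lambda>z. f (v z)) -` (- {0}) = {z\<in>\<Omega>1. f (v z) \<noteq> 0}" by auto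
  ultimately show ?thesis by simp
qed

end

theory Submission
  imports Defs "HOL-Complex_Analysis.Complex_Analysis"
begin

text \<open>
  Where \<open>f (v z) \<noteq> 0\<close>, a holomorphic change of the dependent variable makes the nonlinear
  equation linear. Near \<open>v z0\<close> the function \<open>1 / f\<close> has a holomorphic primitive \<open>\<Phi>\<close>, and
  \<open>\<Phi>\<close> has a local holomorphic inverse \<open>\<Psi>\<close> because its derivative does not vanish
  (\<open>local_primitive_of_reciprocal\<close>). By the chain rule
  \<open>dbar (\<Phi> \<circ> v) = dbar v / f (v z) = g = dbar G\<close> almost everywhere, so \<open>h = \<Phi> \<circ> v - G\<close> is
  continuous, has partial derivatives off a countable set, and satisfies \<open>dbar h = 0\<close> almost
  everywhere. The Looman-Menchoff theorem (\<open>looman_menchoff\<close>) says that such an \<open>h\<close> is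
  holomorphic. Hence \<open>v = \<Psi> \<circ> (G + h)\<close> locally (\<open>solution_local_form\<close>), and \<open>v\<close> is as regular
  as \<open>G\<close>, since each regularity class contains the holomorphic functions and is stable under
  sums and under composition with a holomorphic function from outside.

  The depth lies in the Looman-Menchoff theorem, because the partial derivatives of \<open>h\<close> are
  not known to be integrable. Suppose that the relatively closed set of points near which \<open>h\<close> is not
  holomorphic is nonempty. By Baire's theorem some relatively open piece of it is either a
  single point, which is a removable singularity, or a set \<open>F\<close> at whose points the difference
  quotients of \<open>h\<close> along both axes are bounded by one constant \<open>N\<close>. In the second case let
  \<open>R\<close> be a small rectangle that meets \<open>F\<close>. By Cauchy's theorem the integral of \<open>h\<close> around
  \<open>R\<close> equals the one around the bounding box of \<open>F \<inter> R\<close>, each of whose sides meets \<open>F\<close>. On a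
  line that meets \<open>F\<close>, the increment of \<open>h\<close> across the box is the integral of the partial
  derivative over \<open>F\<close> up to \<open>N\<close> times the length of the part outside \<open>F\<close>
  (\<open>increment_estimate_off_closed_set\<close>). On a line that misses \<open>F\<close> the increment is still
  bounded, through the points of \<open>F\<close> on the sides of the box. Integrating over all
  lines (\<open>saks_estimate\<close>) shows that the contour integral is \<open>\<i>\<close> times the integral of
  \<open>2 * dbar h = 0\<close> over \<open>F\<close>, up to a constant times the area of \<open>R - F\<close>
  (\<open>cell_estimate\<close>). The error is then removed by quartering \<open>R\<close>
  again and again: only the cells that meet \<open>F\<close> contribute, so the area of \<open>R - F\<close> is replaced by
  the area of ever thinner neighbourhoods of \<open>F\<close> with \<open>F\<close> removed, which tends to 0
  (\<open>rect_integral_null\<close>). Morera's theorem then makes \<open>h\<close> holomorphic across \<open>F\<close>,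
  a contradiction.

  For real analytic functions, stability under composition is read off from the weighted
  \<open>l\<^sup>1\<close> norm of the coefficients of a double power series, which is subadditive and
  submultiplicative (\<open>series_norm_le\<close>).
\<close>

section \<open>Increments of a function along a line, seen from a closed set\<close>

lemma difference_quotient_sequence:
  fixes f :: "real \<Rightarrow> 'a::real_normed_vector"
  assumes "(f has_vector_derivative D) (at t)"
  shows "(\<lambda>n. real (Suc n) *\<^sub>R (f (t + 1 / real (Suc n)) - f t)) \<longlonglongrightarrow> D"
proof -
  define \<delta> where "\<delta> n = 1 / real (Suc n)" for n
  have pos: "\<delta> n > 0" for n by (simp add: \<delta>_def)
  have \<delta>: "filterlim \<delta> (at 0) sequentially"
    unfolding filterlim_at \<delta>_def by (auto intro!: always_eventually LIMSEQ_inverse_real_of_nat simp: divide_inverse simp del: of_nat_Suc)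
  have "((\<lambda>h. norm (f (t + h) - f t - h *\<^sub>R D) / norm h) \<longlongrightarrow> 0) (at 0)"
    using assms unfolding has_vector_derivative_def has_derivative_at by simp
  from filterlim_compose[OF this \<delta>]
  have lim: "(\<lambda>n. norm (f (t + \<delta> n) - f t - \<delta> n *\<^sub>R D) / norm (\<delta> n)) \<longlonglongrightarrow> 0" .
  have "norm (f (t + \<delta> n) - f t - \<delta> n *\<^sub>R D) / norm (\<delta> n) = norm (real (Suc n) *\<^sub>R (f (t + \<delta> n) - f t) - D)" for n
  proof -
    have "real (Suc n) *\<^sub>R (f (t + \<delta> n) - f t) - D = real (Suc n) *\<^sub>R (f (t + \<delta> n) - f t - \<delta> n *\<^sub>R D)"
      by (simp add: \<delta>_def scaleR_diff_right del: of_nat_Suc)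
    then show ?thesis using pos[of n] by (simp add: \<delta>_def del: of_nat_Suc)
  qed
  with lim show ?thesis by (simp add: tendsto_norm_zero_iff Lim_null[symmetric] LIM_zero_iff \<delta>_def del: of_nat_Suc)
qed

text \<open>
  The difference quotients of \<open>W\<close> with step \<open>1 / (n + 1)\<close> are bounded by \<open>N\<close> and converge to \<open>W'\<close>
  off a countable set, so their integrals converge to that of \<open>W'\<close> by dominated convergence.
  These integrals are difference quotients, at \<open>b\<close> and at \<open>a\<close>, of a primitive of \<open>W\<close>, and
  therefore converge to \<open>W b - W a\<close>.
\<close>

lemma lipschitz_fundamental_theorem:
  fixes W :: "real \<Rightarrow> 'a::euclidean_space"
  assumes ab: "a \<le> b" and B: "countable B"
    and lip: "\<And>s t. s \<in> {a..b} \<Longrightarrow> t \<in> {a..b} \<Longrightarrow> norm (W s - W t) \<le> N * \<bar>s - t\<bar>"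
    and der: "\<And>t. t \<in> {a<..<b} - B \<Longrightarrow> (W has_vector_derivative W' t) (at t)"
  shows "(W' has_integral (W b - W a)) {a..b}"
proof (cases "a = b")
  case False
  with ab have ab: "a < b" by simp
  have N: "N \<ge> 0"
  proof -
    have "0 \<le> N * \<bar>b - a\<bar>" using lip[of b a] ab order_trans[OF norm_ge_zero] by auto
    then show ?thesis using ab by (simp add: zero_le_mult_iff)
  qed
  \<comment> \<open>\<open>V\<close> extends \<open>W\<close> by constants beyond \<open>a\<close> and \<open>b\<close>, so that shifted arguments are harmless.\<close>
  define cl where "cl t = max a (min b t)" for t
  have cl: "cl t \<in> {a..b}" "\<bar>cl s - cl t\<bar> \<le> \<bar>s - t\<bar>" for s t using ab by (auto simp: cl_def)
  define V where "V t = W (cl t)" for t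
  have Vlip: "norm (V s - V t) \<le> N * \<bar>s - t\<bar>" for s t
    unfolding V_def using lip[OF cl(1) cl(1), of s t] mult_left_mono[OF cl(2) N, of s t] by linarith
  have "continuous_on UNIV V"
  proof (rule lipschitz_on_continuous_on)
    show "lipschitz_on N UNIV V"
      by (rule lipschitz_onI) (use Vlip N in \<open>auto simp: dist_norm\<close>)
  qed
  then have Vc: "continuous_on S V" for S using continuous_on_subset by blast
  define \<Phi> where "\<Phi> t = integral {a-1..t} V" for t
  have \<Phi>: "(\<Phi> has_vector_derivative V t) (at t)" if "a - 1 < t" for t
  proof -
    have "(\<Phi> has_vector_derivative V t) (at t within {a-1..t+1})"
      unfolding \<Phi>_def by (rule integral_has_vector_derivative) (use Vc that in auto)
    then have "(\<Phi> has_vector_derivative V t) (at t within {a-1<..<t+1})"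
      by (rule has_vector_derivative_within_subset) auto
    then show ?thesis using that by (subst (asm) at_within_open) auto
  qed
  define Z where "Z = insert a (insert b B)"
  have Z: "countable Z" unfolding Z_def using B by auto
  define q where "q n t = real (Suc n) *\<^sub>R (V (t + 1 / real (Suc n)) - V t)" for n t
  have q_int: "(q n has_integral real (Suc n) *\<^sub>R (\<Phi> (b + 1 / real (Suc n)) - \<Phi> b)
       - real (Suc n) *\<^sub>R (\<Phi> (a + 1 / real (Suc n)) - \<Phi> a)) {a..b}" for n
  proof -
    have "((\<lambda>t. real (Suc n) *\<^sub>R (V (t + 1 / real (Suc n)) - V t)) has_integral
       real (Suc n) *\<^sub>R (\<Phi> (b + 1 / real (Suc n)) - \<Phi> b)
       - real (Suc n) *\<^sub>R (\<Phi> (a + 1 / real (Suc n)) - \<Phi> a)) {a..b}"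
    proof -
      have "((\<lambda>t. real (Suc n) *\<^sub>R (\<Phi> (t + 1 / real (Suc n)) - \<Phi> t)) has_vector_derivative
           real (Suc n) *\<^sub>R (V (t + 1 / real (Suc n)) - V t)) (at t within {a..b})"
        if t: "t \<in> {a..b}" for t
      proof -
        have 1: "((\<lambda>t. t + 1 / real (Suc n)) has_vector_derivative 1) (at t)"
          by (auto intro!: derivative_eq_intros)
        have 2: "(\<Phi> has_vector_derivative V (t + 1 / real (Suc n))) (at (t + 1 / real (Suc n)))"
        proof (rule \<Phi>)
          have "1 / real (Suc n) > 0" by simp
          moreover have "a \<le> t" using t by simp
          ultimately show "a - 1 < t + 1 / real (Suc n)" by linarith
        qed
        have 3: "((\<lambda>t. \<Phi> (t + 1 / real (Suc n))) has_vector_derivative V (t + 1 / real (Suc n))) (at t)"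
          using vector_diff_chain_at[OF 1 2] by (simp add: o_def)
        have "((\<lambda>t. real (Suc n) *\<^sub>R (\<Phi> (t + 1 / real (Suc n)) - \<Phi> t)) has_vector_derivative
           real (Suc n) *\<^sub>R (V (t + 1 / real (Suc n)) - V t)) (at t)"
          using t by (intro bounded_linear.has_vector_derivative[OF bounded_linear_scaleR_right] has_vector_derivative_diff 3 \<Phi>) auto
        then show ?thesis by (rule has_vector_derivative_at_within)
      qed
      from fundamental_theorem_of_calculus[OF less_imp_le[OF ab] this]
      show ?thesis .
    qed
    then show ?thesis by (simp add: q_def[abs_def])
  qed
  define q' where "q' n t = (if t \<in> Z then 0 else q n t)" for n t
  define D where "D t = (if t \<in> Z then 0 else W' t)" for t
  have neg: "negligible Z" using countable_imp_null_set_lborel[OF Z] by (simp add: negligible_iff_null_sets null_sets_completionI)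
  have q'_int: "(q' n has_integral real (Suc n) *\<^sub>R (\<Phi> (b + 1 / real (Suc n)) - \<Phi> b)
       - real (Suc n) *\<^sub>R (\<Phi> (a + 1 / real (Suc n)) - \<Phi> a)) {a..b}" for n
    by (rule has_integral_spike[OF neg _ q_int]) (auto simp: q'_def)
  have lim: "(\<lambda>n. integral {a..b} (q' n)) \<longlonglongrightarrow> V b - V a"
    unfolding integral_unique[OF q'_int]
    by (intro tendsto_diff difference_quotient_sequence \<Phi>) (use ab in auto)
  have bound: "norm (q' n t) \<le> N" for n t
  proof -
    have "norm (q n t) = real (Suc n) * norm (V (t + 1 / real (Suc n)) - V t)" by (simp add: q_def del: of_nat_Suc)
    also have "\<dots> \<le> real (Suc n) * (N * \<bar>t + 1 / real (Suc n) - t\<bar>)"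
      by (intro mult_left_mono Vlip) auto
    also have "\<dots> = N" by simp
    finally show ?thesis using N by (simp add: q'_def)
  qed
  have conv: "(\<lambda>n. q' n t) \<longlonglongrightarrow> D t" if t: "t \<in> {a..b}" for t
  proof (cases "t \<in> Z")
    case False
    then have t: "t \<in> {a<..<b} - B" using t by (auto simp: Z_def)
    have "(V has_vector_derivative W' t) (at t)"
      by (rule has_vector_derivative_transform_within_open[OF der[OF t], of "{a<..<b}"])
         (use t in \<open>auto simp: V_def cl_def\<close>)
    from difference_quotient_sequence[OF this] show ?thesis
      using False by (simp add: q'_def D_def q_def)
  qed (auto simp: q'_def D_def)
  have *: "D integrable_on {a..b}" "(\<lambda>n. integral {a..b} (q' n)) \<longlonglongrightarrow> integral {a..b} D"
    using dominated_convergence[of q' "{a..b}" "\<lambda>_. N" D] q'_int bound conv by (auto simp: has_integral_integrable_integral)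
  with lim have "integral {a..b} D = V b - V a" using LIMSEQ_unique by blast
  with *(1) have "(D has_integral (V b - V a)) {a..b}" by (simp add: has_integral_integrable_integral)
  then have "(W' has_integral (V b - V a)) {a..b}"
    by (rule has_integral_spike[OF neg, rotated]) (auto simp: D_def)
  then show ?thesis using ab by (simp add: V_def cl_def)
qed auto


text \<open>
  Distinct points that are isolated from the right are followed by disjoint gaps, and each gap contains a
  rational number.
\<close>

lemma countable_right_isolated:
  fixes K :: "real set"
  shows "countable {t\<in>K. \<exists>u>t. {t<..<u} \<inter> K = {}}" (is "countable ?R")
proof -
  have "\<exists>q\<in>\<rat>. t < q \<and> {t<..<q} \<inter> K = {}" if "t \<in> ?R" for t
  proof -
    from that obtain u where u: "u > t" "{t<..<u} \<inter> K = {}" by blast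
    from Rats_dense_in_real[OF u(1)] obtain q where "q \<in> \<rat>" "t < q" "q < u" by blast
    moreover have "{t<..<q} \<subseteq> {t<..<u}" using \<open>q < u\<close> by auto
    ultimately show ?thesis using u(2) by blast
  qed
  then have "\<forall>t\<in>?R. \<exists>q. q \<in> \<rat> \<and> t < q \<and> {t<..<q} \<inter> K = {}" by blast
  from bchoice[OF this] obtain q where
    q: "\<And>t. t \<in> ?R \<Longrightarrow> q t \<in> \<rat>" "\<And>t. t \<in> ?R \<Longrightarrow> t < q t" "\<And>t. t \<in> ?R \<Longrightarrow> {t<..<q t} \<inter> K = {}" by blast
  have less: "q t < q t'" if "t \<in> ?R" "t' \<in> ?R" "t < t'" for t t'
  proof -
    have "t' \<notin> {t<..<q t}" using q(3)[OF that(1)] that(2) by blast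
    then have "q t \<le> t'" using that(3) by simp
    then show ?thesis using q(2)[OF that(2)] by simp
  qed
  have "inj_on q ?R" by (rule linorder_inj_onI', rule less_imp_neq, rule less)
  moreover have "countable (q ` ?R)" by (rule countable_subset[OF _ countable_rat]) (use q(1) in blast)
  ultimately show ?thesis using countable_image_inj_eq by blast
qed

lemma countable_left_isolated:
  fixes K :: "real set"
  shows "countable {t\<in>K. \<exists>u<t. {u<..<t} \<inter> K = {}}" (is "countable ?L")
proof -
  have "{t\<in>K. \<exists>u<t. {u<..<t} \<inter> K = {}} \<subseteq> uminus ` {t\<in>uminus ` K. \<exists>u>t. {t<..<u} \<inter> uminus ` K = {}}"
  proof
    fix t assume "t \<in> ?L"
    then obtain u where u: "t \<in> K" "u < t" "{u<..<t} \<inter> K = {}" by blast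
    then have "{-t<..<-u} \<inter> uminus ` K = {}" by fastforce
    moreover have "-t \<in> uminus ` K" "-u > -t" using u by auto
    ultimately have "-t \<in> {t\<in>uminus ` K. \<exists>u>t. {t<..<u} \<inter> uminus ` K = {}}" by blast
    then show "t \<in> uminus ` {t\<in>uminus ` K. \<exists>u>t. {t<..<u} \<inter> uminus ` K = {}}"
      by (rule image_eqI[rotated]) simp
  qed
  then show ?thesis by (rule countable_subset[OF _ countable_image[OF countable_right_isolated]])
qed

text \<open>
  Only the values of \<open>w\<close> on \<open>K\<close> enter, so \<open>w\<close> may oscillate wildly between the points of
  \<open>K\<close>. Replacing it in each gap of \<open>K\<close> by linear interpolation gives a Lipschitz function
  \<open>W\<close> with the same increment. At a two-sided limit point of \<open>K\<close> the function \<open>W\<close> inherits the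
  derivative of \<open>w\<close>, because the distance to that point is itself affine on each gap; all
  other points of \<open>K\<close> are countably many. The slopes in the gaps are at most \<open>N\<close>, and their
  integral is the error term.
\<close>

lemma increment_estimate_off_closed_set:
  fixes w w' :: "real \<Rightarrow> 'a::euclidean_space"
  assumes K: "closed K" "K \<subseteq> {a..b}" "a \<in> K" "b \<in> K" and B: "countable B"
    and lip: "\<And>s t. s \<in> K \<Longrightarrow> t \<in> K \<Longrightarrow> norm (w s - w t) \<le> N * \<bar>s - t\<bar>"
    and N: "N \<ge> 0"
    and der: "\<And>t. t \<in> K - B \<Longrightarrow> (w has_vector_derivative w' t) (at t within K)"
    and zero: "\<And>t. t \<notin> K \<Longrightarrow> w' t = 0"
    and int: "(w' has_integral I) {a..b}"
  shows "norm (w b - w a - I) \<le> N * measure lborel ({a..b} - K)"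
proof -
  have ab: "a \<le> b" using K by auto
  define lo where "lo t = Sup (K \<inter> {..t})" for t
  define hi where "hi t = Inf (K \<inter> {t..})" for t
  have bdd: "bdd_above (K \<inter> {..t})" "bdd_below (K \<inter> {t..})" for t
    by (auto intro!: bdd_aboveI[of _ t] bdd_belowI[of _ t])
  have lo: "lo t \<in> K" "lo t \<le> t" if "a \<le> t" for t
  proof -
    have "lo t \<in> K \<inter> {..t}" unfolding lo_def
      by (rule closed_contains_Sup) (use K that bdd in \<open>auto intro!: closed_Int\<close>)
    then show "lo t \<in> K" "lo t \<le> t" by auto
  qed
  have hi: "hi t \<in> K" "t \<le> hi t" if "t \<le> b" for t
  proof -
    have "hi t \<in> K \<inter> {t..}" unfolding hi_def
      by (rule closed_contains_Inf) (use K that bdd in \<open>auto intro!: closed_Int\<close>)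
    then show "hi t \<in> K" "t \<le> hi t" by auto
  qed
  have le_lo: "p \<le> lo t" if "p \<in> K" "p \<le> t" for p t
    unfolding lo_def using that bdd by (intro cSup_upper) auto
  have hi_le: "hi t \<le> p" if "p \<in> K" "t \<le> p" for p t
    unfolding hi_def using that bdd by (intro cInf_lower) auto
  have K_lo_hi: "lo t = t" "hi t = t" if "t \<in> K" for t
    using that le_lo[of t t] hi_le[of t t] lo[of t] hi[of t] K(2) by (auto intro!: antisym)
  define slope where "slope t = (if t \<in> K then 0 else (w (hi t) - w (lo t)) /\<^sub>R (hi t - lo t))" for t
  \<comment> \<open>\<open>W\<close> agrees with \<open>w\<close> on \<open>K\<close>, where \<open>lo t = t\<close>, and is linear on each gap from \<open>lo t\<close> to \<open>hi t\<close>.\<close>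
  define W where "W t = w (lo t) + (t - lo t) *\<^sub>R slope t" for t
  have W_K: "W t = w t" if "t \<in> K" for t using that by (simp add: W_def slope_def K_lo_hi)
  have lohi: "lo t < t" "t < hi t" if "t \<in> {a..b} - K" for t
    using that lo[of t] hi[of t] by (auto simp: order.order_iff_strict)
  have slope_le: "norm (slope t) \<le> N" if "t \<in> {a..b}" for t
  proof (cases "t \<in> K")
    case False
    with that have t: "t \<in> {a..b} - K" by simp
    have "norm (w (hi t) - w (lo t)) \<le> N * \<bar>hi t - lo t\<bar>"
      using t lo hi by (intro lip) auto
    then show ?thesis using False lohi[OF t] by (simp add: slope_def divide_le_eq mult.commute flip: divide_inverse_commute)
  qed (simp add: slope_def N)
  \<comment> \<open>Interpolation preserves a first order estimate at \<open>t0\<close> with the same constant. It is used with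
      \<open>D = 0\<close> for the Lipschitz bound and with \<open>D = w' t0\<close> for the derivative.\<close>
  have key: "norm (W t - w t0 - (t - t0) *\<^sub>R D) \<le> \<epsilon> * \<bar>t - t0\<bar>"
    if t: "t \<in> {a..b}" and t0: "t0 \<in> K"
      and p: "\<And>p. p \<in> {lo t, hi t} \<Longrightarrow> norm (w p - w t0 - (p - t0) *\<^sub>R D) \<le> \<epsilon> * \<bar>p - t0\<bar>" for t t0 D \<epsilon>
  proof (cases "t \<in> K")
    case True
    then show ?thesis using p[of t] by (simp add: W_K K_lo_hi)
  next
    case False
    with t have t': "t \<in> {a..b} - K" by simp
    define \<theta> where "\<theta> = (t - lo t) / (hi t - lo t)"
    have \<theta>: "0 \<le> \<theta>" "\<theta> \<le> 1" using lohi[OF t'] by (auto simp: \<theta>_def field_simps)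
    have ne: "hi t - lo t \<noteq> 0" using lohi[OF t'] by simp
    have t_eq: "t = (1 - \<theta>) * lo t + \<theta> * hi t"
    proof -
      have "\<theta> * (hi t - lo t) = t - lo t" using ne by (simp add: \<theta>_def)
      then show ?thesis by (simp add: algebra_simps)
    qed
    have W_eq: "W t = (1 - \<theta>) *\<^sub>R w (lo t) + \<theta> *\<^sub>R w (hi t)"
      using False by (simp add: W_def slope_def \<theta>_def divide_inverse algebra_simps)
    have "W t - w t0 - (t - t0) *\<^sub>R D = (1 - \<theta>) *\<^sub>R (w (lo t) - w t0 - (lo t - t0) *\<^sub>R D)
        + \<theta> *\<^sub>R (w (hi t) - w t0 - (hi t - t0) *\<^sub>R D)"
      unfolding W_eq by (subst t_eq) (simp add: algebra_simps)
    also have "norm \<dots> \<le> (1 - \<theta>) * norm (w (lo t) - w t0 - (lo t - t0) *\<^sub>R D)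
        + \<theta> * norm (w (hi t) - w t0 - (hi t - t0) *\<^sub>R D)"
      by (rule order.trans[OF norm_triangle_ineq]) (use \<theta> in simp)
    also have "\<dots> \<le> (1 - \<theta>) * (\<epsilon> * \<bar>lo t - t0\<bar>) + \<theta> * (\<epsilon> * \<bar>hi t - t0\<bar>)"
      using \<theta> p by (intro add_mono mult_left_mono) auto
    also have "\<dots> = \<epsilon> * \<bar>t - t0\<bar>"
    proof (cases "t0 \<le> t")
      case True
      then have "t0 \<le> lo t" using le_lo t0 by auto
      then have "(1 - \<theta>) * (\<epsilon> * \<bar>lo t - t0\<bar>) + \<theta> * (\<epsilon> * \<bar>hi t - t0\<bar>) = \<epsilon> * (((1 - \<theta>) * lo t + \<theta> * hi t) - t0)"
        using lohi[OF t'] by (simp add: algebra_simps)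
      then show ?thesis using True by (simp flip: t_eq)
    next
      case F: False
      then have "hi t \<le> t0" using hi_le t0 by auto
      then have "(1 - \<theta>) * (\<epsilon> * \<bar>lo t - t0\<bar>) + \<theta> * (\<epsilon> * \<bar>hi t - t0\<bar>) = \<epsilon> * (t0 - ((1 - \<theta>) * lo t + \<theta> * hi t))"
        using lohi[OF t'] by (simp add: algebra_simps)
      then show ?thesis using F by (simp flip: t_eq)
    qed
    finally show ?thesis .
  qed
  have W_lip_K: "norm (W t - w k) \<le> N * \<bar>t - k\<bar>" if "t \<in> {a..b}" "k \<in> K" for t k
    using key[OF that, of 0 N] lip lo[of t] hi[of t] that by auto
  have affine: "W s = w (lo t) + (s - lo t) *\<^sub>R slope t" "s \<notin> K" if "t \<in> {a..b} - K" "lo t < s" "s < hi t" for s t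
  proof -
    have notK: "p \<notin> K" if "lo t < p" "p < hi t" for p
      using le_lo[of p t] hi_le[of p t] that by fastforce
    then show s: "s \<notin> K" using that by simp
    have K': "lo t \<in> K" "hi t \<in> K" using that lo hi by auto
    then have sab: "s \<in> {a..b}" using that K(2) by fastforce
    with s have s': "s \<in> {a..b} - K" by simp
    have "lo s = lo t"
    proof (rule antisym)
      show "lo t \<le> lo s" using le_lo[OF K'(1)] that by simp
      show "lo s \<le> lo t" using notK[of "lo s"] lo[of s] sab lohi[OF s'] that by fastforce
    qed
    moreover have "hi s = hi t"
    proof (rule antisym)
      show "hi s \<le> hi t" using hi_le[OF K'(2)] that by simp
      show "hi t \<le> hi s" using notK[of "hi s"] hi[of s] sab lohi[OF s'] that by fastforce
    qed
    ultimately show "W s = w (lo t) + (s - lo t) *\<^sub>R slope t" using s that by (simp add: W_def slope_def)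
  qed
  have lip1: "norm (W s - W t) \<le> N * (t - s)" if st: "s \<in> {a..b}" "t \<in> {a..b}" "s \<le> t" for s t
  proof (cases "\<exists>k\<in>K. s \<le> k \<and> k \<le> t")
    case True
    then obtain k where k: "k \<in> K" "s \<le> k" "k \<le> t" by blast
    have "norm (W s - W t) \<le> norm (W s - w k) + norm (W t - w k)"
      using norm_triangle_ineq4[of "W s - w k" "W t - w k"] by simp
    also have "\<dots> \<le> N * \<bar>s - k\<bar> + N * \<bar>t - k\<bar>" by (intro add_mono W_lip_K) (use st k in auto)
    also have "\<dots> = N * (t - s)" using k by (simp add: algebra_simps)
    finally show ?thesis .
  next
    case False
    with st have s: "s \<in> {a..b} - K" and t: "t \<notin> K" by auto
    have "t < hi s" using False hi[of s] st by (metis atLeastAtMost_iff not_le)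
    then have "W t = w (lo s) + (t - lo s) *\<^sub>R slope s" using affine[OF s, of t] lohi[OF s] st by auto
    then have "W s - W t = (s - t) *\<^sub>R slope s" by (simp add: W_def algebra_simps)
    then show ?thesis using slope_le[of s] st by (simp add: mult_right_mono mult.commute abs_if)
  qed
  have W_lip: "norm (W s - W t) \<le> N * \<bar>s - t\<bar>" if "s \<in> {a..b}" "t \<in> {a..b}" for s t
    using lip1[of s t] lip1[of t s] that by (cases "s \<le> t") (auto simp: norm_minus_commute)
  define C where "C = B \<union> {t\<in>K. \<exists>u>t. {t<..<u} \<inter> K = {}} \<union> {t\<in>K. \<exists>u<t. {u<..<t} \<inter> K = {}}"
  have C: "countable C" unfolding C_def using B countable_left_isolated countable_right_isolated by blast
  have W_der: "(W has_vector_derivative w' t + slope t) (at t)" if t: "t \<in> {a<..<b} - C" for t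
  proof (cases "t \<in> K")
    case False
    with t have t': "t \<in> {a..b} - K" by simp
    have "((\<lambda>s. w (lo t) + (s - lo t) *\<^sub>R slope t) has_vector_derivative slope t) (at t)"
      by (auto intro!: derivative_eq_intros)
    then have "(W has_vector_derivative slope t) (at t)"
      by (rule has_vector_derivative_transform_within_open[of _ _ _ "{lo t<..<hi t}"])
         (use lohi[OF t'] affine[OF t'] in auto)
    then show ?thesis using zero False by simp
  next
    case True
    have lim: "\<exists>p\<in>K. t < p \<and> p < u" if "t < u" for u
      using t True that by (fastforce simp: C_def)
    have lim': "\<exists>p\<in>K. u < p \<and> p < t" if "u < t" for u
      using t True that by (fastforce simp: C_def)
    have dw: "(w has_derivative (\<lambda>h. h *\<^sub>R w' t)) (at t within K)"
      using der[of t] t True by (auto simp: C_def has_vector_derivative_def)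
    have "(W has_derivative (\<lambda>h. h *\<^sub>R w' t)) (at t)"
      unfolding has_derivative_at_alt
    proof (intro conjI allI impI)
      show "bounded_linear (\<lambda>h. h *\<^sub>R w' t)" by (rule bounded_linear_scaleR_left)
      fix e :: real assume e: "e > 0"
      with dw obtain d where d: "d > 0"
        and de: "\<And>y. y \<in> K \<Longrightarrow> norm (y - t) < d \<Longrightarrow> norm (w y - w t - (y - t) *\<^sub>R w' t) \<le> e * norm (y - t)"
        unfolding has_derivative_within_alt by blast
      obtain p where p: "p \<in> K" "t < p" "p < t + d" using lim[of "t + d"] d by auto
      obtain p' where p': "p' \<in> K" "t - d < p'" "p' < t" using lim'[of "t - d"] d by auto
      define d' where "d' = min (p - t) (t - p')"
      show "\<exists>d>0. \<forall>y. norm (y - t) < d \<longrightarrow> norm (W y - W t - (y - t) *\<^sub>R w' t) \<le> e * norm (y - t)"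
      proof (intro exI[of _ d'] conjI allI impI)
        show "d' > 0" using p p' by (simp add: d'_def)
        fix y assume y: "norm (y - t) < d'"
        then have y': "p' \<le> y" "y \<le> p" by (auto simp: d'_def abs_if split: if_splits)
        with p p' K(2) have yab: "y \<in> {a..b}" by fastforce
        have "p' \<le> lo y" "hi y \<le> p" using y' p p' le_lo hi_le by auto
        moreover have "lo y \<in> K" "hi y \<in> K" "lo y \<le> y" "y \<le> hi y" using lo hi yab by auto
        ultimately have "norm (W y - w t - (y - t) *\<^sub>R w' t) \<le> e * \<bar>y - t\<bar>"
          using p p' y' by (intro key yab True) (auto intro!: de[unfolded real_norm_def])
        then show "norm (W y - W t - (y - t) *\<^sub>R w' t) \<le> e * norm (y - t)" using True by (simp add: W_K)
      qed
    qed
    then show ?thesis using True by (simp add: has_vector_derivative_def slope_def)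
  qed
  have "((\<lambda>t. w' t + slope t) has_integral (W b - W a)) {a..b}"
    by (rule lipschitz_fundamental_theorem[OF ab C W_lip W_der]) auto
  from has_integral_diff[OF this int] have sl: "(slope has_integral (w b - w a - I)) {a..b}"
    using K by (simp add: W_K)
  have meas: "{a..b} - K \<in> lmeasurable"
    by (rule bounded_set_imp_lmeasurable[OF bounded_subset[OF bounded_closed_interval, of _ a b]])
      (use K(1) in auto)
  have *: "((\<lambda>t. N * indicator ({a..b} - K) t) has_integral (N * measure lborel ({a..b} - K))) {a..b}"
  proof -
    have "(indicator ({a..b} - K) has_integral measure lebesgue ({a..b} - K)) UNIV"
      using meas by (simp only: lmeasurable_iff_has_integral)
    then have "(indicator ({a..b} - K) has_integral measure lebesgue ({a..b} - K)) {a..b}"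
    proof -
      have "(\<lambda>t. if t \<in> {a..b} then indicator ({a..b} - K) t else 0 :: real) = indicator ({a..b} - K)"
        by (auto simp: indicator_def)
      with \<open>(indicator ({a..b} - K) has_integral measure lebesgue ({a..b} - K)) UNIV\<close>
      show ?thesis using has_integral_restrict_UNIV[of "{a..b}" "indicator ({a..b} - K) :: real \<Rightarrow> real"] by simp
    qed
    moreover have "measure lebesgue ({a..b} - K) = measure lborel ({a..b} - K)"
      using K(1) by (intro measure_completion) auto
    ultimately show ?thesis using has_integral_mult_right by metis
  qed
  have "norm (integral {a..b} slope) \<le> integral {a..b} (\<lambda>t. N * indicator ({a..b} - K) t)"
  proof (rule integral_norm_bound_integral[rotated 2])
    show "norm (slope t) \<le> N * indicator ({a..b} - K) t" if "t \<in> {a..b}" for t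
      using slope_le[OF that] that by (cases "t \<in> K") (simp_all add: slope_def)
  qed (use sl * in auto)
  then show ?thesis unfolding integral_unique[OF sl] integral_unique[OF *] .
qed

section \<open>Increments across a rectangle and the area integral of a partial derivative\<close>

text \<open>
  Fubini's theorem with the outer integral as a gauge integral, the form in which the boundary integrals
  of a rectangle appear.
\<close>

lemma has_integral_iterated_lborel:
  fixes f :: "real \<times> real \<Rightarrow> 'a::euclidean_space"
  assumes "integrable lborel f"
  shows "((\<lambda>x. \<integral>y. f (x, y) \<partial>lborel) has_integral (\<integral>z. f z \<partial>lborel)) UNIV"
proof -
  have f: "integrable (lborel \<Otimes>\<^sub>M lborel) f" using assms by (simp add: lborel_prod)
  have "((\<lambda>x. \<integral>y. f (x, y) \<partial>lborel) has_integral (\<integral>x. \<integral>y. f (x, y) \<partial>lborel \<partial>lborel)) UNIV"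
    by (rule has_integral_integral_lborel[OF lborel_pair.integrable_fst'[OF f]])
  then show ?thesis using lborel_pair.integral_fst'[OF f] by (simp add: lborel_prod)
qed

lemma integrable_lborel_bounded_support:
  fixes f :: "'b::euclidean_space \<Rightarrow> 'a::euclidean_space"
  assumes "f \<in> borel_measurable borel" "bounded A" "A \<in> sets borel"
    and "\<And>x. x \<in> A \<Longrightarrow> norm (f x) \<le> N" "\<And>x. x \<notin> A \<Longrightarrow> f x = 0"
  shows "integrable lborel f"
  by (rule integrableI_bounded_set[of A _ _ N]) (use assms emeasure_bounded_finite[of A] in auto)

text \<open>
  This is an estimate of Saks. On a vertical line that meets \<open>F\<close>,
  \<open>increment_estimate_off_closed_set\<close> applies. On a vertical
  line that misses \<open>F\<close>, a path from the bottom to the top of the box through \<open>p\<close> and \<open>q\<close>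
  bounds the increment by \<open>N * (3 * (b - a) + (d - c))\<close>; since the whole segment of length
  \<open>d - c\<close> then lies outside \<open>F\<close>, this is again a multiple of the length of the part outside \<open>F\<close>.
  Integrating over the lines turns lengths into areas.
\<close>

lemma saks_estimate:
  fixes w wy :: "real \<Rightarrow> real \<Rightarrow> complex"
  assumes ab: "a < b" "c < d" and sub: "a \<le> a1" "b1 \<le> b" "c \<le> c1" "d1 \<le> d"
    and F: "compact F" "F \<subseteq> {a1..b1} \<times> {c1..d1}" "p \<in> F" "snd p = c1" "q \<in> F" "snd q = d1"
    and cont: "continuous_on ({a..b} \<times> {c..d}) (\<lambda>(x, y). w x y)" and N: "0 \<le> N"
    and lipx: "\<And>x y x'. (x, y) \<in> F \<Longrightarrow> x' \<in> {a..b} \<Longrightarrow> norm (w x' y - w x y) \<le> N * \<bar>x' - x\<bar>"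
    and lipy: "\<And>x y y'. (x, y) \<in> F \<Longrightarrow> y' \<in> {c..d} \<Longrightarrow> norm (w x y' - w x y) \<le> N * \<bar>y' - y\<bar>"
    and B: "countable B"
    and der: "\<And>x y. (x, y) \<in> F - B \<Longrightarrow> (w x has_vector_derivative wy x y) (at y)"
    and meas: "(\<lambda>(x, y). wy x y) \<in> borel_measurable borel"
    and zero: "\<And>x y. (x, y) \<notin> F \<Longrightarrow> wy x y = 0"
    and bound: "\<And>x y. norm (wy x y) \<le> N"
  shows "norm (integral {a1..b1} (\<lambda>x. w x d1 - w x c1) - (\<integral>z. wy (fst z) (snd z) \<partial>lborel))
      \<le> N * (3 * (b - a) / (d - c) + 1) * measure lborel ({a..b} \<times> {c..d} - F)"
proof -
  define \<kappa> where "\<kappa> = N * (3 * (b - a) / (d - c) + 1)"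
  have \<kappa>: "N \<le> \<kappa>" "0 \<le> \<kappa>" using N ab by (auto simp: \<kappa>_def mult_le_cancel_left1 intro!: mult_nonneg_nonneg add_nonneg_nonneg)
  define R where "R = {a..b} \<times> {c..d}"
  have FR: "F \<subseteq> R" using F(2) sub by (auto simp: R_def)
  have Fc: "closed F" using F(1) by (rule compact_imp_closed)
  have c1d1: "c1 \<le> d1" "a1 \<le> b1" using F(2,3) by auto
  have sec: "closed {y. (x, y) \<in> F}" for x
    using closed_vimage[OF Fc, of "Pair x"]
    by (simp add: vimage_def continuous_on_Pair)
  have mx: "wy x \<in> borel_measurable borel" for x
    using measurable_compose[OF measurable_Pair1' meas[folded borel_prod]] by (auto simp: borel_prod)
  have zero': "wy x y = 0" if "y \<notin> {c1..d1}" for x y by (rule zero) (use F(2) that in auto)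
  have int_x: "integrable lborel (wy x)" for x
    by (rule integrable_lborel_bounded_support[OF mx, of "{c1..d1}" _ N]) (use bound zero' in auto)
  define I where "I x = (\<integral>y. wy x y \<partial>lborel)" for x
  have I: "(wy x has_integral I x) {c1..d1}" for x
  proof -
    have "(wy x has_integral I x) UNIV" unfolding I_def by (rule has_integral_integral_lborel[OF int_x])
    moreover have "(\<lambda>y. if y \<in> {c1..d1} then wy x y else 0) = wy x" using zero' by fastforce
    ultimately show ?thesis using has_integral_restrict_UNIV[of "{c1..d1}" "wy x" "I x"] by simp
  qed
  define e where "e x = w x d1 - w x c1 - I x" for x
  define m where "m x = (\<integral>y. indicator (R - F) (x, y) \<partial>lborel :: real)" for x
  have m_eq: "m x = measure lborel ({c..d} - {y. (x, y) \<in> F})" if "x \<in> {a..b}" for x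
  proof -
    have "(\<lambda>y. indicator (R - F) (x, y) :: real) = indicator ({c..d} - {y. (x, y) \<in> F})"
      using that by (auto simp: indicator_def R_def)
    then show ?thesis unfolding m_def using sec[of x] by simp
  qed
  have m_nonneg: "m x \<ge> 0" for x unfolding m_def by (rule integral_nonneg_AE) auto
  have e_le: "norm (e x) \<le> \<kappa> * m x" if x: "x \<in> {a1..b1}" for x
  proof -
    have xab: "x \<in> {a..b}" using x sub by auto
    show ?thesis
    proof (cases "{y. (x, y) \<in> F} = {}")
      case True
      then have I0: "I x = 0" using zero by (simp add: I_def)
      obtain xp xq where xp: "(xp, c1) \<in> F" and xq: "(xq, d1) \<in> F" using F(3-6) by (metis prod.collapse)
      have xpq: "xp \<in> {a..b}" "xq \<in> {a..b}" using FR xp xq by (auto simp: R_def)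
      have "norm (w x d1 - w xq d1) \<le> N * (b - a)"
        by (rule order.trans[OF lipx[OF xq xab]]) (use xpq xab N in \<open>auto intro!: mult_left_mono\<close>)
      moreover have "norm (w xq c1 - w xp c1) \<le> N * (b - a)"
        by (rule order.trans[OF lipx[OF xp xpq(2)]]) (use xpq xab N in \<open>auto intro!: mult_left_mono\<close>)
      moreover have "norm (w x c1 - w xp c1) \<le> N * (b - a)"
        by (rule order.trans[OF lipx[OF xp xab]]) (use xpq xab N in \<open>auto intro!: mult_left_mono\<close>)
      moreover have "norm (w xq c1 - w xq d1) \<le> N * (d - c)"
        by (rule order.trans[OF lipy[OF xq]]) (use sub c1d1 N in \<open>auto intro!: mult_left_mono\<close>)
      moreover have "norm (w x d1 - w x c1) \<le> norm (w x d1 - w xq d1) + norm (w xq c1 - w xq d1)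
           + norm (w xq c1 - w xp c1) + norm (w x c1 - w xp c1)"
      proof -
        have eq: "w x d1 - w x c1 = (w x d1 - w xq d1) - (w xq c1 - w xq d1) + (w xq c1 - w xp c1) - (w x c1 - w xp c1)"
          by simp
        show ?thesis
          unfolding eq using norm_triangle_ineq4[of "w x d1 - w xq d1 - (w xq c1 - w xq d1) + (w xq c1 - w xp c1)" "w x c1 - w xp c1"]
            norm_triangle_ineq[of "w x d1 - w xq d1 - (w xq c1 - w xq d1)" "w xq c1 - w xp c1"]
            norm_triangle_ineq4[of "w x d1 - w xq d1" "w xq c1 - w xq d1"] by linarith
      qed
      ultimately have "norm (w x d1 - w x c1) \<le> N * (3 * (b - a) + (d - c))" by (simp add: algebra_simps)
      also have "\<dots> = \<kappa> * (d - c)" using ab by (simp add: \<kappa>_def field_simps)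
      also have "d - c = m x" using m_eq[OF xab] True ab by simp
      finally show ?thesis by (simp add: e_def I0)
    next
      case False
      then obtain k where k: "(x, k) \<in> F" by blast
      have kcd: "c1 \<le> k" "k \<le> d1" using F(2) k by auto
      define K where "K = insert c1 (insert d1 {y. (x, y) \<in> F})"
      have K_sub: "K \<subseteq> {c1..d1}" using F(2) c1d1 by (auto simp: K_def)
      have one: "norm (w x s - w x t) \<le> N * \<bar>s - t\<bar>" if "s \<in> K" "(x, t) \<in> F" for s t
        using lipy[OF that(2), of s] that(1) K_sub sub by auto
      have two: "norm (w x d1 - w x c1) \<le> N * \<bar>d1 - c1\<bar>"
      proof -
        have "norm (w x d1 - w x c1) \<le> norm (w x d1 - w x k) + norm (w x c1 - w x k)"
          using norm_triangle_ineq4[of "w x d1 - w x k" "w x c1 - w x k"] by simp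
        also have "\<dots> \<le> N * \<bar>d1 - k\<bar> + N * \<bar>c1 - k\<bar>" by (intro add_mono one k) (auto simp: K_def)
        also have "\<dots> = N * \<bar>d1 - c1\<bar>" using kcd by (simp add: algebra_simps)
        finally show ?thesis .
      qed
      have lipK: "norm (w x s - w x t) \<le> N * \<bar>s - t\<bar>" if "s \<in> K" "t \<in> K" for s t
        using that one[of s t] one[of t s] two unfolding K_def
        by (auto simp: norm_minus_commute abs_minus_commute)
      have "norm (w x d1 - w x c1 - I x) \<le> N * measure lborel ({c1..d1} - K)"
      proof (rule increment_estimate_off_closed_set[where B = "insert c1 (insert d1 {y. (x, y) \<in> B})"])
        show "closed K" using sec[of x] by (simp add: K_def)
        have "{y. (x, y) \<in> B} \<subseteq> snd ` B" by force
        then show "countable (insert c1 (insert d1 {y. (x, y) \<in> B}))"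
          using countable_subset[OF _ countable_image[OF B]] by simp
        show "(w x has_vector_derivative wy x t) (at t within K)"
          if "t \<in> K - insert c1 (insert d1 {y. (x, y) \<in> B})" for t
          using der[of x t] that by (auto simp: K_def intro: has_vector_derivative_at_within)
      qed (use K_sub lipK N I[of x] zero in \<open>auto simp: K_def\<close>)
      also have "measure lborel ({c1..d1} - K) \<le> measure lborel ({c..d} - {y. (x, y) \<in> F})"
      proof (rule measure_mono_fmeasurable)
        show "{c..d} - {y. (x, y) \<in> F} \<in> fmeasurable lborel"
          by (rule fmeasurableI2[of "{c..d}"]) (use sec[of x] emeasure_bounded_finite[of "{c..d}"] in \<open>auto simp: fmeasurable_def\<close>)
        show "{c1..d1} - K \<in> sets lborel" using sec[of x] by (simp add: K_def)
      qed (use sub in \<open>auto simp: K_def\<close>)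
      finally have "norm (e x) \<le> N * m x" using N m_eq[OF xab] by (simp add: e_def mult_left_mono)
      also have "\<dots> \<le> \<kappa> * m x" using \<kappa> m_nonneg by (intro mult_right_mono) auto
      finally show ?thesis .
    qed
  qed
  have "compact R" unfolding R_def by (intro compact_Times) auto
  then have Rb: "bounded (R - F)" "R - F \<in> sets borel"
    using Fc by (auto intro: bounded_subset[OF compact_imp_bounded] borel_closed compact_imp_closed)
  have "integrable lborel (indicator (R - F) :: real \<times> real \<Rightarrow> real)"
    by (rule integrable_lborel_bounded_support[OF _ Rb, of _ 1]) (use Rb in auto)
  from has_integral_iterated_lborel[OF this]
  have m_int: "(m has_integral measure lborel (R - F)) UNIV"
    using Rb by (simp add: m_def[abs_def])
  have Fb: "bounded F" "F \<in> sets borel" using F(1) Fc by (auto intro: compact_imp_bounded)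
  have "integrable lborel (\<lambda>(x, y). wy x y)"
    by (rule integrable_lborel_bounded_support[OF meas Fb, of N]) (use bound zero in auto)
  from has_integral_iterated_lborel[OF this]
  have "(I has_integral (\<integral>z. wy (fst z) (snd z) \<partial>lborel)) UNIV"
    by (simp add: I_def[abs_def] case_prod_beta)
  moreover have "(\<lambda>x. if x \<in> {a1..b1} then I x else 0) = I"
  proof
    fix x
    have "I x = 0" if "x \<notin> {a1..b1}"
    proof -
      have "wy x y = 0" for y by (rule zero) (use F(2) that in auto)
      then show ?thesis by (simp add: I_def)
    qed
    then show "(if x \<in> {a1..b1} then I x else 0) = I x" by auto
  qed
  ultimately have I_int: "(I has_integral (\<integral>z. wy (fst z) (snd z) \<partial>lborel)) {a1..b1}"
    using has_integral_restrict_UNIV[of "{a1..b1}" I] by simp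
  have "continuous_on {a1..b1} (\<lambda>x. w x y)" if "y \<in> {c..d}" for y
  proof -
    have "continuous_on {a1..b1} (\<lambda>x. (x, y))" by (intro continuous_intros)
    moreover have "(\<lambda>x. (x, y)) ` {a1..b1} \<subseteq> {a..b} \<times> {c..d}" using that sub by auto
    ultimately show ?thesis using continuous_on_compose2[OF cont] by fastforce
  qed
  then have w_int: "(\<lambda>x. w x d1 - w x c1) integrable_on {a1..b1}"
    using sub c1d1 by (intro integrable_continuous_real continuous_intros) auto
  have e_int: "(e has_integral (integral {a1..b1} (\<lambda>x. w x d1 - w x c1) - (\<integral>z. wy (fst z) (snd z) \<partial>lborel))) {a1..b1}"
    unfolding e_def[abs_def] by (intro has_integral_diff I_int integrable_integral w_int)
  then have e_int': "((\<lambda>x. if x \<in> {a1..b1} then e x else 0) has_integral (integral {a1..b1} (\<lambda>x. w x d1 - w x c1) - (\<integral>z. wy (fst z) (snd z) \<partial>lborel))) UNIV"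
    by (simp only: has_integral_restrict_UNIV)
  have \<kappa>m: "((\<lambda>x. \<kappa> * m x) has_integral \<kappa> * measure lborel (R - F)) UNIV"
    by (intro has_integral_mult_right m_int)
  have "norm (integral UNIV (\<lambda>x. if x \<in> {a1..b1} then e x else 0)) \<le> integral UNIV (\<lambda>x. \<kappa> * m x)"
  proof (rule integral_norm_bound_integral[rotated 2])
    show "norm (if x \<in> {a1..b1} then e x else 0) \<le> \<kappa> * m x" for x
      using e_le \<kappa> m_nonneg by auto
  qed (use e_int' \<kappa>m in blast)+
  then show ?thesis unfolding integral_unique[OF e_int'] integral_unique[OF \<kappa>m] by (simp add: \<kappa>_def R_def)
qed

section \<open>Contour integrals over rectangles\<close>

text \<open>
  The integral of \<open>h\<close> along the boundary of the rectangle in the positive sense, with opposite sides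
  combined.
\<close>

definition rect_integral :: "(complex \<Rightarrow> complex) \<Rightarrow> real \<Rightarrow> real \<Rightarrow> real \<Rightarrow> real \<Rightarrow> complex" where
  "rect_integral h a b c d =
     \<i> * integral {c..d} (\<lambda>y. h (Complex b y) - h (Complex a y))
       - integral {a..b} (\<lambda>x. h (Complex x d) - h (Complex x c))"

lemma continuous_on_horizontal:
  assumes "continuous_on (cbox (Complex a c) (Complex b d)) h" "y \<in> {c..d}" "{a'..b'} \<subseteq> {a..b}"
  shows "continuous_on {a'..b'} (\<lambda>x. h (Complex x y))"
  by (rule continuous_on_compose2[OF assms(1), of _ "\<lambda>x. Complex x y"])
     (use assms in \<open>auto simp: in_cbox_complex_iff Complex_eq intro!: continuous_intros\<close>)

lemma continuous_on_vertical:
  assumes "continuous_on (cbox (Complex a c) (Complex b d)) h" "x \<in> {a..b}" "{c'..d'} \<subseteq> {c..d}"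
  shows "continuous_on {c'..d'} (\<lambda>y. h (Complex x y))"
  by (rule continuous_on_compose2[OF assms(1), of _ "\<lambda>y. Complex x y"])
     (use assms in \<open>auto simp: in_cbox_complex_iff Complex_eq intro!: continuous_intros\<close>)

lemma rect_integral_split_x:
  assumes h: "continuous_on (cbox (Complex a c) (Complex b d)) h" and m: "a \<le> m" "m \<le> b" "c \<le> d"
  shows "rect_integral h a b c d = rect_integral h a m c d + rect_integral h m b c d"
proof -
  have v: "(\<lambda>y. h (Complex x y)) integrable_on {c..d}" if "x \<in> {a..b}" for x
    by (intro integrable_continuous_real continuous_on_vertical[OF h that]) auto
  have "(\<lambda>x. h (Complex x d) - h (Complex x c)) integrable_on {a..b}"
    by (intro integrable_continuous_real continuous_intros continuous_on_horizontal[OF h]) (use m in auto)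
  from Henstock_Kurzweil_Integration.integral_combine[OF m(1,2) this]
  show ?thesis using m by (simp add: rect_integral_def integral_diff v algebra_simps)
qed

lemma rect_integral_split_y:
  assumes h: "continuous_on (cbox (Complex a c) (Complex b d)) h" and m: "a \<le> b" "c \<le> m" "m \<le> d"
  shows "rect_integral h a b c d = rect_integral h a b c m + rect_integral h a b m d"
proof -
  have v: "(\<lambda>x. h (Complex x y)) integrable_on {a..b}" if "y \<in> {c..d}" for y
    by (intro integrable_continuous_real continuous_on_horizontal[OF h that]) auto
  have "(\<lambda>y. h (Complex b y) - h (Complex a y)) integrable_on {c..d}"
    by (intro integrable_continuous_real continuous_intros continuous_on_vertical[OF h]) (use m in auto)
  note combine = Henstock_Kurzweil_Integration.integral_combine[OF m(2,3) this, symmetric]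
  show ?thesis using m by (simp add: rect_integral_def integral_diff v combine algebra_simps)
qed

text \<open>
  Cauchy's theorem for a function continuous up to the boundary: such a function has a primitive on the
  closed rectangle, and the boundary integral telescopes.
\<close>

lemma rect_integral_eq_0:
  assumes h: "continuous_on (cbox (Complex a c) (Complex b d)) h" and ab: "a \<le> b" "c \<le> d"
    and hol: "\<And>z. z \<in> box (Complex a c) (Complex b d) \<Longrightarrow> h field_differentiable at z"
  shows "rect_integral h a b c d = 0"
proof -
  let ?S = "cbox (Complex a c) (Complex b d)"
  obtain g where g: "\<And>z. z \<in> ?S \<Longrightarrow> (g has_field_derivative h z) (at z within ?S)"
    using holomorphic_convex_primitive[OF convex_box(1) finite.emptyI h] hol by (auto simp: interior_cbox)
  have hor: "((\<lambda>x. h (Complex x y)) has_integral g (Complex b y) - g (Complex a y)) {a..b}" if y: "y \<in> {c..d}" for y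
  proof (rule fundamental_theorem_of_calculus[OF ab(1)])
    fix x assume x: "x \<in> {a..b}"
    have 1: "((\<lambda>x. Complex x y) has_vector_derivative 1) (at x within {a..b})"
      unfolding Complex_eq by (auto intro!: derivative_eq_intros)
    have 2: "(g has_field_derivative h (Complex x y)) (at (Complex x y) within (\<lambda>x. Complex x y) ` {a..b})"
      by (rule has_field_derivative_subset[OF g]) (use x y in \<open>auto simp: in_cbox_complex_iff\<close>)
    show "((\<lambda>x. g (Complex x y)) has_vector_derivative h (Complex x y)) (at x within {a..b})"
      using field_vector_diff_chain_within[OF 1 2] by (simp add: o_def)
  qed
  have ver: "((\<lambda>y. \<i> * h (Complex x y)) has_integral g (Complex x d) - g (Complex x c)) {c..d}" if x: "x \<in> {a..b}" for x
  proof (rule fundamental_theorem_of_calculus[OF ab(2)])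
    fix y assume y: "y \<in> {c..d}"
    have 1: "((\<lambda>y. Complex x y) has_vector_derivative \<i>) (at y within {c..d})"
      unfolding Complex_eq by (auto intro!: derivative_eq_intros)
    have 2: "(g has_field_derivative h (Complex x y)) (at (Complex x y) within (\<lambda>y. Complex x y) ` {c..d})"
      by (rule has_field_derivative_subset[OF g]) (use x y in \<open>auto simp: in_cbox_complex_iff\<close>)
    show "((\<lambda>y. g (Complex x y)) has_vector_derivative \<i> * h (Complex x y)) (at y within {c..d})"
      using field_vector_diff_chain_within[OF 1 2] by (simp add: o_def)
  qed
  have "((\<lambda>y. \<i> * h (Complex b y) - \<i> * h (Complex a y)) has_integral
      (g (Complex b d) - g (Complex b c)) - (g (Complex a d) - g (Complex a c))) {c..d}"
    by (intro has_integral_diff ver) (use ab in auto)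
  then have 1: "\<i> * integral {c..d} (\<lambda>y. h (Complex b y) - h (Complex a y)) =
      (g (Complex b d) - g (Complex b c)) - (g (Complex a d) - g (Complex a c))"
    unfolding integral_mult_right[symmetric] by (simp add: integral_unique right_diff_distrib)
  have "((\<lambda>x. h (Complex x d) - h (Complex x c)) has_integral
      (g (Complex b d) - g (Complex a d)) - (g (Complex b c) - g (Complex a c))) {a..b}"
    by (intro has_integral_diff hor) (use ab in auto)
  then show ?thesis unfolding rect_integral_def 1 by (simp add: integral_unique)
qed

text \<open>
  The region between the two rectangles is cut into four rectangles, left, right, below and above, to
  each of which Cauchy's theorem applies.
\<close>

lemma rect_integral_shrink:
  assumes h: "continuous_on (cbox (Complex a c) (Complex b d)) h"
    and ord: "a \<le> a1" "a1 \<le> b1" "b1 \<le> b" "c \<le> c1" "c1 \<le> d1" "d1 \<le> d"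
    and hol: "\<And>z. z \<in> cbox (Complex a c) (Complex b d) - cbox (Complex a1 c1) (Complex b1 d1) \<Longrightarrow> h field_differentiable at z"
  shows "rect_integral h a b c d = rect_integral h a1 b1 c1 d1"
proof -
  have sub: "continuous_on (cbox (Complex a' c') (Complex b' d')) h" if "a \<le> a'" "b' \<le> b" "c \<le> c'" "d' \<le> d" for a' b' c' d'
    by (rule continuous_on_subset[OF h]) (use that in \<open>auto simp: in_cbox_complex_iff\<close>)
  have zero: "rect_integral h a' b' c' d' = 0"
    if "a \<le> a'" "b' \<le> b" "c \<le> c'" "d' \<le> d" "a' \<le> b'" "c' \<le> d'" "b' \<le> a1 \<or> b1 \<le> a' \<or> d' \<le> c1 \<or> d1 \<le> c'" for a' b' c' d'
    by (rule rect_integral_eq_0[OF sub], (use that in simp_all)[6])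
       (rule hol, use that in \<open>auto simp: in_cbox_complex_iff in_box_complex_iff\<close>)
  have "rect_integral h a b c d = rect_integral h a a1 c d + (rect_integral h a1 b1 c d + rect_integral h b1 b c d)"
    using rect_integral_split_x[OF h, of a1] rect_integral_split_x[OF sub, of a1 b c d b1] ord by simp
  also have "\<dots> = rect_integral h a1 b1 c d" using zero ord by simp
  also have "\<dots> = rect_integral h a1 b1 c c1 + (rect_integral h a1 b1 c1 d1 + rect_integral h a1 b1 d1 d)"
    using rect_integral_split_y[OF sub, of a1 b1 c d c1] rect_integral_split_y[OF sub, of a1 b1 c1 d d1] ord by simp
  also have "\<dots> = rect_integral h a1 b1 c1 d1" using zero ord by simp
  finally show ?thesis .
qed

section \<open>Contour integrals near a singular set with bounded difference quotients\<close>

text \<open>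
  Identifies Lebesgue measure on the complex plane with the product measure, so that Fubini's theorem
  and null sets can be moved between the two.
\<close>

lemma lborel_complex_eq: "lborel = distr lborel borel (\<lambda>z. Complex (fst z) (snd z))"
proof (rule lborel_eqI)
  fix l u :: complex assume le: "\<And>b. b \<in> Basis \<Longrightarrow> l \<bullet> b \<le> u \<bullet> b"
  have vim: "(\<lambda>z. Complex (fst z) (snd z)) -` box l u = {Re l<..<Re u} \<times> {Im l<..<Im u}"
    by (auto simp: in_box_complex_iff)
  have meas: "(\<lambda>z. Complex (fst z) (snd z)) \<in> lborel \<rightarrow>\<^sub>M borel"
    by (auto simp: Complex_eq intro!: borel_measurable_continuous_onI continuous_intros)
  have "emeasure (distr lborel borel (\<lambda>z. Complex (fst z) (snd z))) (box l u) =
      emeasure (lborel \<Otimes>\<^sub>M lborel) ({Re l<..<Re u} \<times> {Im l<..<Im u})"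
    by (subst emeasure_distr[OF meas]) (simp_all add: vim lborel_prod)
  also have "\<dots> = ennreal (Re u - Re l) * ennreal (Im u - Im l)"
    using le[of 1] le[of \<i>] by (subst lborel.emeasure_pair_measure_Times) (auto simp: Basis_complex_def)
  finally show "emeasure (distr lborel borel (\<lambda>z. Complex (fst z) (snd z))) (box l u) = (\<Prod>b\<in>Basis. (u - l) \<bullet> b)"
    using le[of 1] le[of \<i>] by (simp add: Basis_complex_def ennreal_mult)
qed simp

lemma AE_lborel_complex_pair:
  assumes "AE z in lebesgue. P (z::complex)"
  shows "AE z in lborel. P (Complex (fst z) (snd z))"
proof -
  have "(\<lambda>z::real \<times> real. Complex (fst z) (snd z)) \<in> lborel \<rightarrow>\<^sub>M borel"
    by (auto simp: Complex_eq intro!: borel_measurable_continuous_onI continuous_intros)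
  moreover have "AE z in distr lborel borel (\<lambda>z. Complex (fst z) (snd z)). P z"
    using assms unfolding AE_completion_iff lborel_complex_eq[symmetric] .
  ultimately show ?thesis by (rule AE_distrD)
qed

text \<open>
  A directional derivative is a pointwise limit of difference quotients, and these become Borel functions
  once \<open>h\<close> is extended by 0 outside \<open>U\<close>.
\<close>

lemma borel_measurable_directional_limit:
  fixes h D :: "complex \<Rightarrow> complex"
  assumes U: "open U" "continuous_on U h" and S: "S \<in> sets borel" "S \<subseteq> U"
    and D: "\<And>z. z \<in> S \<Longrightarrow> (\<lambda>n. real (Suc n) *\<^sub>R (h (z + complex_of_real (1 / real (Suc n)) * u) - h z)) \<longlonglongrightarrow> D z"
  shows "(\<lambda>z. if z \<in> S then D z else 0) \<in> borel_measurable borel"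
proof -
  define h' where "h' z = (if z \<in> U then h z else 0)" for z
  have h'[measurable]: "h' \<in> borel_measurable borel"
    unfolding h'_def using U by (intro borel_measurable_continuous_on_if) auto
  note S(1)[measurable]
  define f where "f n z = (if z \<in> S then real (Suc n) *\<^sub>R (h' (z + complex_of_real (1 / real (Suc n)) * u) - h' z) else 0)" for n z
  show ?thesis
  proof (rule borel_measurable_LIMSEQ_metric)
    show "f n \<in> borel_measurable borel" for n unfolding f_def by measurable
    show "(\<lambda>n. f n z) \<longlonglongrightarrow> (if z \<in> S then D z else 0)" for z
    proof (cases "z \<in> S")
      case True
      then have "z \<in> U" using S by auto
      have "(\<lambda>n. z + complex_of_real (1 / real (Suc n)) * u) \<longlonglongrightarrow> z + complex_of_real 0 * u"
        by (intro tendsto_intros LIMSEQ_Suc[OF lim_1_over_n])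
      then have "\<forall>\<^sub>F n in sequentially. z + complex_of_real (1 / real (Suc n)) * u \<in> U"
        using topological_tendstoD[OF _ U(1)] \<open>z \<in> U\<close> by simp
      then have "\<forall>\<^sub>F n in sequentially. f n z = real (Suc n) *\<^sub>R (h (z + complex_of_real (1 / real (Suc n)) * u) - h z)"
        by eventually_elim (use True \<open>z \<in> U\<close> in \<open>simp add: f_def h'_def\<close>)
      then show ?thesis using D[OF True] True by (simp add: tendsto_cong)
    qed (simp add: f_def)
  qed
qed

text \<open>
  The situation that the Baire category argument produces: \<open>F\<close> contains all points of \<open>Q\<close> at which \<open>h\<close>
  might fail to be complex differentiable, and the difference quotients at the points of \<open>F\<close> are
  bounded by \<open>N\<close> for all steps up to \<open>\<rho>\<close>. The exceptional set \<open>B\<close> carries the points without partial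
  derivatives.
\<close>

locale thin_singular_set =
  fixes h :: "complex \<Rightarrow> complex" and U Q F B :: "complex set" and N \<rho> :: real
  assumes U: "open U" "continuous_on U h" and QU: "Q \<subseteq> U" and F: "compact F" "F \<subseteq> U"
    and hol: "\<And>z. z \<in> Q - F \<Longrightarrow> h field_differentiable at z"
    and N: "0 \<le> N" and \<rho>: "0 < \<rho>"
    and lipx: "\<And>z t. z \<in> F \<Longrightarrow> \<bar>t\<bar> \<le> \<rho> \<Longrightarrow> norm (h (z + complex_of_real t) - h z) \<le> N * \<bar>t\<bar>"
    and lipy: "\<And>z t. z \<in> F \<Longrightarrow> \<bar>t\<bar> \<le> \<rho> \<Longrightarrow> norm (h (z + complex_of_real t * \<i>) - h z) \<le> N * \<bar>t\<bar>"
    and B: "countable B"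
    and partials: "\<And>z. z \<in> F - B \<Longrightarrow> partials_exist h z"
    and ae: "AE z in lebesgue. z \<in> F \<longrightarrow> dbar h z = 0"
begin

lemma directional_derivative_measurable_and_bounded:
  assumes S: "S \<in> sets borel" "S \<subseteq> F"
    and D: "\<And>z. z \<in> S \<Longrightarrow> ((\<lambda>t. h (z + complex_of_real t * u)) has_vector_derivative D z) (at 0)"
    and lip: "\<And>z t. z \<in> F \<Longrightarrow> \<bar>t\<bar> \<le> \<rho> \<Longrightarrow> norm (h (z + complex_of_real t * u) - h z) \<le> N * \<bar>t\<bar>"
  shows "(\<lambda>z. if z \<in> S then D z else 0) \<in> borel_measurable borel"
    and "\<And>z. z \<in> S \<Longrightarrow> norm (D z) \<le> N"
proof -
  have lim: "(\<lambda>n. real (Suc n) *\<^sub>R (h (z + complex_of_real (1 / real (Suc n)) * u) - h z)) \<longlonglongrightarrow> D z" if "z \<in> S" for z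
    using difference_quotient_sequence[OF D[OF that]] by simp
  show "(\<lambda>z. if z \<in> S then D z else 0) \<in> borel_measurable borel"
    by (rule borel_measurable_directional_limit[OF U S(1) _ lim]) (use S F in auto)
  show "norm (D z) \<le> N" if z: "z \<in> S" for z
  proof (rule tendsto_upperbound[OF tendsto_norm[OF lim[OF z]]])
    have "(\<lambda>n. 1 / real (Suc n)) \<longlonglongrightarrow> 0" by (rule LIMSEQ_Suc[OF lim_1_over_n])
    then have "\<forall>\<^sub>F n in sequentially. 1 / real (Suc n) < \<rho>" using \<rho> by (rule order_tendstoD)
    then show "\<forall>\<^sub>F n in sequentially.
        norm (real (Suc n) *\<^sub>R (h (z + complex_of_real (1 / real (Suc n)) * u) - h z)) \<le> N"
    proof eventually_elim
      case (elim n)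
      have "norm (h (z + complex_of_real (1 / real (Suc n)) * u) - h z) \<le> N * \<bar>1 / real (Suc n)\<bar>"
        by (rule lip) (use z S elim in auto)
      then have "real (Suc n) * norm (h (z + complex_of_real (1 / real (Suc n)) * u) - h z) \<le> real (Suc n) * (N * \<bar>1 / real (Suc n)\<bar>)"
        by (rule mult_left_mono) simp
      then show ?case by (simp del: of_nat_Suc)
    qed
  qed simp
qed

text \<open>
  Both pairs of opposite sides of the bounding box of \<open>F \<inter> R\<close> are compared with area integrals by
  \<open>saks_estimate\<close>, the second pair after exchanging the coordinates. The two area integrals
  cancel because \<open>dbar h = 0\<close> almost everywhere on \<open>F\<close>. The constant depends on the rectangle
  only through its aspect ratio, which quartering preserves.
\<close>

lemma cell_estimate:
  assumes R: "cbox (Complex a c) (Complex b d) \<subseteq> Q" "a < b" "c < d" "b - a \<le> \<rho>" "d - c \<le> \<rho>"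
    and meet: "cbox (Complex a c) (Complex b d) \<inter> F \<noteq> {}"
  shows "norm (rect_integral h a b c d) \<le> N * (3 * (b - a) / (d - c) + 3 * (d - c) / (b - a) + 2)
      * measure lborel ({a..b} \<times> {c..d} - {(x, y). Complex x y \<in> F})"
proof -
  define P where "P z = Complex (fst z) (snd z)" for z
  have P_cont: "continuous_on S P" for S
    unfolding P_def Complex_eq by (auto intro!: continuous_intros)
  define F' where "F' = {z \<in> {a..b} \<times> {c..d}. P z \<in> F}"
  have F'_eq: "{a..b} \<times> {c..d} - {(x, y). Complex x y \<in> F} = {a..b} \<times> {c..d} - F'"
    by (auto simp: F'_def P_def)
  have "closed F'"
  proof -
    have "F' = ({a..b} \<times> {c..d}) \<inter> P -` F" by (auto simp: F'_def)
    moreover have "closed (P -` F)" by (rule closed_vimage[OF compact_imp_closed[OF F(1)] P_cont])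
    ultimately show ?thesis by (simp add: closed_Int closed_Times)
  qed
  then have F'c: "compact F'"
    using compact_Int_closed[OF compact_Times[OF compact_Icc compact_Icc], of F' a b c d] by (simp add: F'_def Int_absorb1 Int_def)
  obtain z0 where z0: "z0 \<in> cbox (Complex a c) (Complex b d)" "z0 \<in> F" using meet by blast
  then have "(Re z0, Im z0) \<in> F'" by (auto simp: F'_def P_def in_cbox_complex_iff)
  then have F'ne: "F' \<noteq> {}" by blast
  obtain pa where pa: "pa \<in> F'" "\<And>z. z \<in> F' \<Longrightarrow> fst pa \<le> fst z"
    using continuous_attains_inf[OF F'c F'ne continuous_on_fst[OF continuous_on_id]] by blast
  obtain pb where pb: "pb \<in> F'" "\<And>z. z \<in> F' \<Longrightarrow> fst z \<le> fst pb"
    using continuous_attains_sup[OF F'c F'ne continuous_on_fst[OF continuous_on_id]] by blast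
  obtain pc where pc: "pc \<in> F'" "\<And>z. z \<in> F' \<Longrightarrow> snd pc \<le> snd z"
    using continuous_attains_inf[OF F'c F'ne continuous_on_snd[OF continuous_on_id]] by blast
  obtain pd where pd: "pd \<in> F'" "\<And>z. z \<in> F' \<Longrightarrow> snd z \<le> snd pd"
    using continuous_attains_sup[OF F'c F'ne continuous_on_snd[OF continuous_on_id]] by blast
  define a1 b1 c1 d1 where "a1 = fst pa" and "b1 = fst pb" and "c1 = snd pc" and "d1 = snd pd"
  have sub: "a \<le> a1" "b1 \<le> b" "c \<le> c1" "d1 \<le> d"
    using pa(1) pb(1) pc(1) pd(1) by (auto simp: a1_def b1_def c1_def d1_def F'_def)
  have F'_sub: "F' \<subseteq> {a1..b1} \<times> {c1..d1}" using pa(2) pb(2) pc(2) pd(2) by (fastforce simp: a1_def b1_def c1_def d1_def)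
  have le: "a1 \<le> b1" "c1 \<le> d1" using F'_sub F'ne by auto
  have contQ: "continuous_on (cbox (Complex a c) (Complex b d)) h"
    using U(2) R(1) QU by (meson continuous_on_subset order_trans)
  have contP: "continuous_on ({a..b} \<times> {c..d}) (\<lambda>(x, y). h (Complex x y))"
  proof -
    have "P ` ({a..b} \<times> {c..d}) \<subseteq> cbox (Complex a c) (Complex b d)" by (auto simp: P_def in_cbox_complex_iff)
    from continuous_on_compose2[OF contQ P_cont this] show ?thesis by (simp add: P_def case_prod_beta)
  qed
  have contP': "continuous_on ({c..d} \<times> {a..b}) (\<lambda>(y, x). h (Complex x y))"
  proof -
    have cont: "continuous_on ({c..d} \<times> {a..b}) prod.swap" by (intro continuous_intros)
    have "prod.swap ` ({c..d} \<times> {a..b}) \<subseteq> {a..b} \<times> {c..d}" by auto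
    from continuous_on_compose2[OF contP cont this] show ?thesis by (simp add: case_prod_beta)
  qed
  have shrink: "rect_integral h a b c d = rect_integral h a1 b1 c1 d1"
  proof (rule rect_integral_shrink[OF contQ sub(1) le(1) sub(2,3) le(2) sub(4)])
    fix z assume z: "z \<in> cbox (Complex a c) (Complex b d) - cbox (Complex a1 c1) (Complex b1 d1)"
    then have "(Re z, Im z) \<notin> F'" using F'_sub by (auto simp: in_cbox_complex_iff)
    with z have "z \<notin> F" by (auto simp: F'_def P_def in_cbox_complex_iff)
    then show "h field_differentiable at z" using z R(1) by (intro hol) auto
  qed
  define S where "S = F \<inter> cbox (Complex a c) (Complex b d) - B"
  have "F \<inter> cbox (Complex a c) (Complex b d) \<in> sets borel"
    by (intro borel_closed closed_Int compact_imp_closed F(1) closed_cbox)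
  moreover have "B \<in> sets borel" by (rule sets.countable[OF _ B]) simp
  ultimately have S: "S \<in> sets borel" "S \<subseteq> F"
    unfolding S_def by auto
  have Sdx: "((\<lambda>t. h (Complex t (Im z))) has_vector_derivative dx h z) (at (Re z))"
    and Sdy: "((\<lambda>t. h (Complex (Re z) t)) has_vector_derivative dy h z) (at (Im z))" if "z \<in> S" for z
  proof -
    have "z \<in> F - B" using that by (auto simp: S_def)
    from partials[OF this] obtain d1 d2 where d: "has_dx h d1 z" "has_dy h d2 z" by (auto simp: partials_exist_def)
    show "((\<lambda>t. h (Complex t (Im z))) has_vector_derivative dx h z) (at (Re z))"
      using d(1) has_dx_imp_dx[OF d(1)] by (simp add: has_dx_def)
    show "((\<lambda>t. h (Complex (Re z) t)) has_vector_derivative dy h z) (at (Im z))"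
      using d(2) has_dy_imp_dy[OF d(2)] by (simp add: has_dy_def)
  qed
  have Sdx0: "((\<lambda>t. h (z + complex_of_real t * 1)) has_vector_derivative dx h z) (at 0)" if "z \<in> S" for z
  proof -
    have "((\<lambda>t. t + Re z) has_vector_derivative 1) (at 0)" by (auto intro!: derivative_eq_intros)
    from vector_diff_chain_at[OF this, of "\<lambda>t. h (Complex t (Im z))" "dx h z"] Sdx[OF that]
    have "((\<lambda>t. h (Complex (t + Re z) (Im z))) has_vector_derivative dx h z) (at 0)" by (simp add: o_def)
    moreover have "Complex (t + Re z) (Im z) = z + complex_of_real t * 1" for t by (simp add: complex_eq_iff)
    ultimately show ?thesis by simp
  qed
  have Sdy0: "((\<lambda>t. h (z + complex_of_real t * \<i>)) has_vector_derivative dy h z) (at 0)" if "z \<in> S" for z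
  proof -
    have "((\<lambda>t. t + Im z) has_vector_derivative 1) (at 0)" by (auto intro!: derivative_eq_intros)
    from vector_diff_chain_at[OF this, of "\<lambda>t. h (Complex (Re z) t)" "dy h z"] Sdy[OF that]
    have "((\<lambda>t. h (Complex (Re z) (t + Im z))) has_vector_derivative dy h z) (at 0)" by (simp add: o_def)
    moreover have "Complex (Re z) (t + Im z) = z + complex_of_real t * \<i>" for t by (simp add: complex_eq_iff)
    ultimately show ?thesis by simp
  qed
  define X where "X z = (if z \<in> S then dx h z else 0)" for z
  define Y where "Y z = (if z \<in> S then dy h z else 0)" for z
  have X: "X \<in> borel_measurable borel" "norm (X z) \<le> N" for z
    using directional_derivative_measurable_and_bounded[OF S Sdx0] lipx N by (auto simp: X_def[abs_def])
  have Y: "Y \<in> borel_measurable borel" "norm (Y z) \<le> N" for z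
    using directional_derivative_measurable_and_bounded[OF S Sdy0] lipy N by (auto simp: Y_def[abs_def])
  have X0: "X (Complex x y) = 0" and Y0: "Y (Complex x y) = 0" if "(x, y) \<notin> F'" for x y
    using that by (auto simp: X_def Y_def S_def F'_def P_def in_cbox_complex_iff)
  have P_meas: "P \<in> borel \<rightarrow>\<^sub>M borel" by (rule borel_measurable_continuous_onI[OF P_cont])
  have XP: "(\<lambda>z. X (P z)) \<in> borel_measurable borel" and YP: "(\<lambda>z. Y (P z)) \<in> borel_measurable borel"
    by (rule measurable_compose[OF P_meas X(1)], rule measurable_compose[OF P_meas Y(1)])
  define B1 where "B1 = (\<lambda>z. (Re z, Im z)) ` B"
  define B2 where "B2 = (\<lambda>z. (Im z, Re z)) ` B"
  have B12: "countable B1" "countable B2" using B by (auto simp: B1_def B2_def)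
  have F'_S: "Complex x y \<in> S" if "(x, y) \<in> F'" "(x, y) \<notin> B1" for x y
    using that by (force simp: S_def F'_def P_def B1_def in_cbox_complex_iff)
  have F'_S': "Complex x y \<in> S" if "(x, y) \<in> F'" "(y, x) \<notin> B2" for x y
    using that by (force simp: S_def F'_def P_def B2_def in_cbox_complex_iff)
  have lipx': "norm (h (Complex x' y) - h (Complex x y)) \<le> N * \<bar>x' - x\<bar>" if "(x, y) \<in> F'" "x' \<in> {a..b}" for x y x'
  proof -
    have "Complex x' y = Complex x y + complex_of_real (x' - x)" by (simp add: complex_eq_iff)
    moreover have "\<bar>x' - x\<bar> \<le> \<rho>" using that R(4) by (auto simp: F'_def)
    ultimately show ?thesis using lipx[of "Complex x y" "x' - x"] that by (simp add: F'_def P_def)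
  qed
  have lipy': "norm (h (Complex x y') - h (Complex x y)) \<le> N * \<bar>y' - y\<bar>" if "(x, y) \<in> F'" "y' \<in> {c..d}" for x y y'
  proof -
    have "Complex x y' = Complex x y + complex_of_real (y' - y) * \<i>" by (simp add: complex_eq_iff)
    moreover have "\<bar>y' - y\<bar> \<le> \<rho>" using that R(5) by (auto simp: F'_def)
    ultimately show ?thesis using lipy[of "Complex x y" "y' - y"] that by (simp add: F'_def P_def)
  qed
  define \<mu> where "\<mu> = measure lborel ({a..b} \<times> {c..d} - F')"
  have 1: "norm (integral {a1..b1} (\<lambda>x. h (Complex x d1) - h (Complex x c1)) - (\<integral>z. Y (Complex (fst z) (snd z)) \<partial>lborel))
      \<le> N * (3 * (b - a) / (d - c) + 1) * \<mu>" unfolding \<mu>_def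
  proof (rule saks_estimate[OF R(2,3) sub F'c F'_sub pc(1) _ pd(1) _ contP N lipx' lipy' B12(1)])
    show "((\<lambda>y. h (Complex x y)) has_vector_derivative Y (Complex x y)) (at y)" if "(x, y) \<in> F' - B1" for x y
      using Sdy[of "Complex x y"] F'_S that by (simp add: Y_def)
    show "(\<lambda>(x, y). Y (Complex x y)) \<in> borel_measurable borel" using YP by (simp add: P_def case_prod_beta)
  qed (auto simp: c1_def d1_def Y Y0)
  have 2: "norm (integral {c1..d1} (\<lambda>y. h (Complex b1 y) - h (Complex a1 y)) - (\<integral>z. X (Complex (snd z) (fst z)) \<partial>lborel))
      \<le> N * (3 * (d - c) / (b - a) + 1) * measure lborel ({c..d} \<times> {a..b} - prod.swap ` F')"
  proof (rule saks_estimate[OF R(3,2) sub(3,4,1,2) _ _ imageI[OF pa(1)] _ imageI[OF pb(1)] _ contP' N _ _ B12(2)])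
    show "compact (prod.swap ` F')" by (rule compact_continuous_image[OF _ F'c]) (intro continuous_intros)
    show "((\<lambda>x. h (Complex x y)) has_vector_derivative X (Complex x y)) (at x)" if "(y, x) \<in> prod.swap ` F' - B2" for x y
      using Sdx[of "Complex x y"] F'_S'[of x y] that by (auto simp: X_def)
    have "(\<lambda>z::real\<times>real. P (prod.swap z)) \<in> borel \<rightarrow>\<^sub>M borel"
      by (rule borel_measurable_continuous_onI, rule continuous_on_compose2[OF P_cont[of UNIV]]) (auto intro!: continuous_intros)
    from measurable_compose[OF this X(1)]
    show "(\<lambda>(y, x). X (Complex x y)) \<in> borel_measurable borel" by (simp add: P_def case_prod_beta)
    show "X (Complex x y) = 0" if "(y, x) \<notin> prod.swap ` F'" for x y
      using that by (intro X0) (auto simp: image_iff)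
  qed (use F'_sub lipx' lipy' in \<open>auto simp: a1_def b1_def X\<close>)
  have swap: "(\<integral>z. f (snd z) (fst z) \<partial>lborel) = (\<integral>z. f (fst z) (snd z) \<partial>lborel)"
    if "(\<lambda>z. f (fst z) (snd z)) \<in> borel_measurable borel" for f :: "real \<Rightarrow> real \<Rightarrow> 'c::{banach, second_countable_topology}"
    using lborel_pair.integral_product_swap[of "\<lambda>z. f (fst z) (snd z)"] that
    by (simp add: lborel_prod case_prod_beta')
  have \<mu>2: "measure lborel ({c..d} \<times> {a..b} - prod.swap ` F') = \<mu>"
  proof -
    have m: "{a..b} \<times> {c..d} - F' \<in> sets borel"
      using \<open>closed F'\<close> by (intro sets.Diff borel_closed closed_Times) auto
    have "compact (prod.swap ` F')" by (rule compact_continuous_image[OF _ F'c]) (intro continuous_intros)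
    then have m': "{c..d} \<times> {a..b} - prod.swap ` F' \<in> sets borel"
      by (intro sets.Diff borel_closed closed_Times compact_imp_closed) auto
    have "\<mu> = (\<integral>z. indicator ({a..b} \<times> {c..d} - F') (fst z, snd z) \<partial>lborel)"
      unfolding \<mu>_def using m by simp
    also have "\<dots> = (\<integral>z. indicator ({a..b} \<times> {c..d} - F') (snd z, fst z) \<partial>lborel)"
      by (rule swap[symmetric]) (use m in simp)
    also have "\<dots> = (\<integral>z. indicator ({c..d} \<times> {a..b} - prod.swap ` F') z \<partial>lborel)"
      by (rule Bochner_Integration.integral_cong) (auto simp: indicator_def image_iff)
    also have "\<dots> = measure lborel ({c..d} \<times> {a..b} - prod.swap ` F')" using m' by simp
    finally show ?thesis by simp
  qed
  have XY: "\<i> * (\<integral>z. X (Complex (snd z) (fst z)) \<partial>lborel) = (\<integral>z. Y (Complex (fst z) (snd z)) \<partial>lborel)"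
  proof -
    have "AE z in lborel. \<i> * X (Complex (fst z) (snd z)) = Y (Complex (fst z) (snd z))"
      using AE_lborel_complex_pair[OF ae]
    proof eventually_elim
      case (elim z)
      show ?case
      proof (cases "Complex (fst z) (snd z) \<in> S")
        case True
        with elim S(2) have "dx h (Complex (fst z) (snd z)) + \<i> * dy h (Complex (fst z) (snd z)) = 0"
          by (auto simp: dbar_def)
        then have "\<i> * (dx h (Complex (fst z) (snd z)) + \<i> * dy h (Complex (fst z) (snd z))) = 0" by simp
        then show ?thesis using True by (simp add: X_def Y_def algebra_simps)
      qed (simp add: X_def Y_def)
    qed
    then have "(\<integral>z. \<i> * X (Complex (fst z) (snd z)) \<partial>lborel) = (\<integral>z. Y (Complex (fst z) (snd z)) \<partial>lborel)"
      using XP YP by (intro integral_cong_AE) (auto simp: P_def)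
    moreover have "(\<integral>z. X (Complex (snd z) (fst z)) \<partial>lborel) = (\<integral>z. X (Complex (fst z) (snd z)) \<partial>lborel)"
      by (rule swap) (use XP in \<open>simp add: P_def\<close>)
    ultimately show ?thesis by simp
  qed
  have "rect_integral h a b c d =
      \<i> * (integral {c1..d1} (\<lambda>y. h (Complex b1 y) - h (Complex a1 y)) - (\<integral>z. X (Complex (snd z) (fst z)) \<partial>lborel))
      - (integral {a1..b1} (\<lambda>x. h (Complex x d1) - h (Complex x c1)) - (\<integral>z. Y (Complex (fst z) (snd z)) \<partial>lborel))"
    unfolding shrink unfolding rect_integral_def XY[symmetric] by (simp add: right_diff_distrib)
  also have "norm \<dots> \<le> N * (3 * (d - c) / (b - a) + 1) * \<mu> + N * (3 * (b - a) / (d - c) + 1) * \<mu>"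
    by (rule order.trans[OF norm_triangle_ineq4 add_mono[OF _ 1]]) (use 2 \<mu>2 in \<open>simp add: norm_mult\<close>)
  also have "\<dots> = N * (3 * (b - a) / (d - c) + 3 * (d - c) / (b - a) + 2) * \<mu>" by (simp add: algebra_simps)
  finally show ?thesis unfolding F'_eq \<mu>_def .
qed

end

section \<open>Vanishing of the contour integrals, and Morera's theorem\<close>

lemma measure_superadditive:
  assumes "A \<in> fmeasurable M" "B \<in> fmeasurable M" "C \<in> fmeasurable M" "A \<inter> B = {}" "A \<union> B \<subseteq> C"
  shows "measure M A + measure M B \<le> measure M C"
proof -
  have "measure M A + measure M B = measure M (A \<union> B)"
    by (rule measure_Union[symmetric]) (use assms in \<open>auto simp: fmeasurable_def\<close>)
  also have "\<dots> \<le> measure M C" using assms by (intro measure_mono_fmeasurable) auto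
  finally show ?thesis .
qed

context thin_singular_set begin

lemma rect_integral_disjoint:
  assumes R: "cbox (Complex a c) (Complex b d) \<subseteq> Q" "a \<le> b" "c \<le> d"
    and disj: "box (Complex a c) (Complex b d) \<inter> F = {}"
  shows "rect_integral h a b c d = 0"
proof (rule rect_integral_eq_0[OF _ R(2,3)])
  show "continuous_on (cbox (Complex a c) (Complex b d)) h"
    using U(2) R(1) QU by (meson continuous_on_subset order_trans)
  fix z assume "z \<in> box (Complex a c) (Complex b d)"
  then show "h field_differentiable at z"
    using R(1) disj box_subset_cbox by (intro hol) blast
qed

text \<open>
  By induction on \<open>k\<close>, the cell estimate improves to the area of those points of \<open>R - F\<close> whose distance
  to \<open>F\<close> is at most \<open>((b - a) + (d - c)) / 2 ^ k\<close>: a cell of the \<open>k\<close>-th quartering that misses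
  \<open>F\<close> contributes nothing, and a cell that meets \<open>F\<close> lies within its own diameter of \<open>F\<close>. As
  \<open>F\<close> is closed, these sets decrease to the empty set.
\<close>

lemma rect_integral_null:
  assumes R: "cbox (Complex a c) (Complex b d) \<subseteq> Q" "a < b" "c < d" "b - a \<le> \<rho>" "d - c \<le> \<rho>"
  shows "rect_integral h a b c d = 0"
proof (cases "F = {}")
  case True
  then show ?thesis using R by (intro rect_integral_disjoint) auto
next
  case False
  define G where "G = {(x, y). Complex x y \<in> F}"
  have "continuous_on UNIV (\<lambda>z. Complex (fst z) (snd z))"
    unfolding Complex_eq by (auto intro!: continuous_intros)
  from closed_vimage[OF compact_imp_closed[OF F(1)] this] have G: "closed G"
    by (simp add: G_def vimage_def case_prod_beta')
  obtain z0 where "z0 \<in> F" using False by blast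
  then have "(Re z0, Im z0) \<in> G" by (simp add: G_def)
  then have Gne: "G \<noteq> {}" by blast
  define r where "r = (b - a) / (d - c)"
  have r: "r > 0" using R by (simp add: r_def)
  define \<kappa> where "\<kappa> = N * (3 * r + 3 / r + 2)"
  have \<kappa>: "\<kappa> \<ge> 0" using r N by (simp add: \<kappa>_def)
  \<comment> \<open>The points off \<open>F\<close> in the open rectangle whose distance to \<open>F\<close> is at most \<open>\<delta>\<close>, in real coordinates.\<close>
  define T where "T a b c d \<delta> = {z \<in> {a<..<b} \<times> {c<..<d}. infdist z G \<le> \<delta>} - G" for a b c d \<delta>
  have T: "T a b c d \<delta> \<in> fmeasurable lborel" for a b c d \<delta>
  proof (rule fmeasurableI2)
    have "emeasure lborel ({a..b} \<times> {c..d}) < \<infinity>"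
      by (rule emeasure_bounded_finite) (intro bounded_Times bounded_closed_interval)
    then show "{a..b} \<times> {c..d} \<in> fmeasurable lborel"
      by (auto simp: fmeasurable_def intro!: borel_closed closed_Times)
    have "closed {z. infdist z G \<le> \<delta>}" by (intro closed_Collect_le continuous_intros)
    moreover have "T a b c d \<delta> = ({a<..<b} \<times> {c<..<d}) \<inter> {z. infdist z G \<le> \<delta>} - G" by (auto simp: T_def)
    moreover have "open ({a<..<b} \<times> {c<..<d})" by (intro open_Times) auto
    ultimately show "T a b c d \<delta> \<in> sets lborel" using G by (auto intro!: sets.Diff sets.Int)
  qed (auto simp: T_def)
  have main: "norm (rect_integral h a b c d) \<le> \<kappa> * measure lborel (T a b c d (((b - a) + (d - c)) / 2 ^ k))"
    if "cbox (Complex a c) (Complex b d) \<subseteq> Q" "a < b" "c < d" "b - a \<le> \<rho>" "d - c \<le> \<rho>" "b - a = r * (d - c)" for a b c d k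
    using that
  proof (induction k arbitrary: a b c d)
    case 0
    note R = "0.prems"
    show ?case
    proof (cases "cbox (Complex a c) (Complex b d) \<inter> F = {}")
      case True
      have "box (Complex a c) (Complex b d) \<inter> F = {}" using True box_subset_cbox by blast
      then have "rect_integral h a b c d = 0"
        using R(2,3) by (intro rect_integral_disjoint R(1)) auto
      then show ?thesis using \<kappa> by simp
    next
      case False
      then obtain p where p: "p \<in> cbox (Complex a c) (Complex b d)" "p \<in> F" by blast
      have pG: "(Re p, Im p) \<in> G" using p by (simp add: G_def)
      \<comment> \<open>The sets \<open>T\<close> use open boxes, so that those of the four quarters are disjoint; the boundary \<open>Z\<close> is a null set.\<close>
      define Z where "Z = cbox (a, c) (b, d) - box (a, c) (b, d)"
      have "Z \<in> null_sets lborel"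
      proof -
        have "Z \<in> sets lborel" unfolding Z_def by simp
        moreover have "Z \<in> null_sets lebesgue"
          unfolding Z_def using negligible_frontier_interval by (simp add: negligible_iff_null_sets)
        ultimately show ?thesis by (simp add: null_sets_completion_iff)
      qed
      let ?T = "T a b c d (((b - a) + (d - c)) / 2 ^ 0)"
      have sub: "{a..b} \<times> {c..d} - G \<subseteq> ?T \<union> Z"
      proof
        fix z assume z: "z \<in> {a..b} \<times> {c..d} - G"
        show "z \<in> ?T \<union> Z"
        proof (cases "z \<in> {a<..<b} \<times> {c<..<d}")
          case True
          have "infdist z G \<le> dist z (Re p, Im p)" using pG by (rule infdist_le)
          also have "\<dots> \<le> \<bar>fst z - Re p\<bar> + \<bar>snd z - Im p\<bar>"
            using sqrt_sum_squares_le_sum_abs[of "fst z - Re p" "snd z - Im p"]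
            by (cases z) (simp add: dist_Pair_Pair dist_real_def)
          also have "\<dots> \<le> (b - a) + (d - c)"
            using z p(1) by (intro add_mono) (auto simp: in_cbox_complex_iff)
          finally show ?thesis using True z by (auto simp: T_def)
        next
          case False
          then show ?thesis using z by (auto simp: Z_def mem_box Basis_prod_def inner_Pair_0)
        qed
      qed
      have TZ: "?T \<union> Z \<in> fmeasurable lborel"
        using T \<open>Z \<in> null_sets lborel\<close> by (intro fmeasurable.Un) (auto simp: fmeasurable_def null_sets_def)
      have "measure lborel ({a..b} \<times> {c..d} - G) \<le> measure lborel (?T \<union> Z)"
        by (rule measure_mono_fmeasurable[OF sub _ TZ]) (use G in \<open>simp add: sets.Diff borel_closed closed_Times\<close>)
      also have "\<dots> = measure lborel ?T"
        by (intro measure_Un_null_set fmeasurableD T) fact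
      finally have le: "measure lborel ({a..b} \<times> {c..d} - G) \<le> measure lborel ?T" .
      have req: "(b - a) / (d - c) = r" "(d - c) / (b - a) = 1 / r" using R(2,3,6) r by auto
      have "norm (rect_integral h a b c d) \<le> N * (3 * ((b - a) / (d - c)) + 3 * ((d - c) / (b - a)) + 2)
         * measure lborel ({a..b} \<times> {c..d} - G)"
        using cell_estimate[OF R(1-5) False] by (simp add: G_def)
      also have "N * (3 * ((b - a) / (d - c)) + 3 * ((d - c) / (b - a)) + 2) = \<kappa>"
        unfolding req by (simp add: \<kappa>_def)
      also have "\<kappa> * measure lborel ({a..b} \<times> {c..d} - G) \<le> \<kappa> * measure lborel ?T"
        using le \<kappa> by (rule mult_left_mono)
      finally show ?thesis .
    qed
  next
    case (Suc k)
    note R = Suc.prems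
    define m n where "m = (a + b) / 2" and "n = (c + d) / 2"
    have mn: "a < m" "m < b" "c < n" "n < d" "m - a = (b - a) / 2" "b - m = (b - a) / 2"
      "n - c = (d - c) / 2" "d - n = (d - c) / 2" using R(2,3) by (auto simp: m_def n_def field_simps)
    have cont: "continuous_on (cbox (Complex a' c') (Complex b' d')) h" if "a \<le> a'" "b' \<le> b" "c \<le> c'" "d' \<le> d" for a' b' c' d'
      by (rule continuous_on_subset[OF U(2)]) (use that R(1) QU in \<open>auto simp: subset_iff in_cbox_complex_iff\<close>)
    define \<delta> where "\<delta> = ((b - a) + (d - c)) / 2 ^ Suc k"
    have IH: "norm (rect_integral h a' b' c' d') \<le> \<kappa> * measure lborel (T a' b' c' d' \<delta>)"
      if "a \<le> a'" "b' \<le> b" "c \<le> c'" "d' \<le> d" "b' - a' = (b - a) / 2" "d' - c' = (d - c) / 2" for a' b' c' d'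
    proof -
      have sub: "cbox (Complex a' c') (Complex b' d') \<subseteq> Q"
        using R(1) that by (auto simp: subset_iff in_cbox_complex_iff)
      have "((b' - a') + (d' - c')) / 2 ^ k = \<delta>" unfolding that(5,6) \<delta>_def by (simp add: field_simps)
      moreover have "a' < b'" "c' < d'" "b' - a' \<le> \<rho>" "d' - c' \<le> \<rho>"
        using that R(2-5) by auto
      moreover have "b' - a' = r * (d' - c')" unfolding that(5,6) R(6) by simp
      ultimately show ?thesis using Suc.IH[OF sub] by simp
    qed
    have "rect_integral h a b c d = (rect_integral h a m c n + rect_integral h a m n d)
        + (rect_integral h m b c n + rect_integral h m b n d)"
      using rect_integral_split_x[OF cont, of a b c d m] rect_integral_split_y[OF cont, of a m c d n]
        rect_integral_split_y[OF cont, of m b c d n] mn by simp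
    also have "norm \<dots> \<le> (norm (rect_integral h a m c n) + norm (rect_integral h a m n d))
        + (norm (rect_integral h m b c n) + norm (rect_integral h m b n d))"
      by (intro order.trans[OF norm_triangle_ineq] add_mono norm_triangle_ineq)
    also have "\<dots> \<le> (\<kappa> * measure lborel (T a m c n \<delta>) + \<kappa> * measure lborel (T a m n d \<delta>))
        + (\<kappa> * measure lborel (T m b c n \<delta>) + \<kappa> * measure lborel (T m b n d \<delta>))"
      by (intro add_mono IH) (use mn in auto)
    also have "\<dots> = \<kappa> * ((measure lborel (T a m c n \<delta>) + measure lborel (T a m n d \<delta>))
        + (measure lborel (T m b c n \<delta>) + measure lborel (T m b n d \<delta>)))" by (simp add: algebra_simps)
    also have "\<dots> \<le> \<kappa> * (measure lborel (T a m c d \<delta>) + measure lborel (T m b c d \<delta>))"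
      by (intro mult_left_mono[OF _ \<kappa>] add_mono measure_superadditive T) (use mn in \<open>auto simp: T_def\<close>)
    also have "\<dots> \<le> \<kappa> * measure lborel (T a b c d \<delta>)"
      by (intro mult_left_mono[OF _ \<kappa>] measure_superadditive T) (use mn in \<open>auto simp: T_def\<close>)
    finally show ?case by (simp only: \<delta>_def)
  qed
  define \<delta> where "\<delta> k = ((b - a) + (d - c)) / 2 ^ k" for k :: nat
  have \<delta>0: "\<delta> \<longlonglongrightarrow> 0" unfolding \<delta>_def by real_asymp
  have dec: "decseq \<delta>" unfolding \<delta>_def using R(2,3) by (intro decseq_SucI divide_left_mono) auto
  have "(\<lambda>k. measure lborel (T a b c d (\<delta> k))) \<longlonglongrightarrow> measure lborel (\<Inter>k. T a b c d (\<delta> k))"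
  proof (rule Lim_measure_decseq)
    show "range (\<lambda>k. T a b c d (\<delta> k)) \<subseteq> sets lborel" using T by (auto simp: fmeasurable_def)
    show "emeasure lborel (T a b c d (\<delta> k)) \<noteq> \<infinity>" for k using T[of a b c d "\<delta> k"] by (auto simp: fmeasurable_def)
    show "decseq (\<lambda>k. T a b c d (\<delta> k))"
      using dec unfolding decseq_def T_def by (force intro: order.trans)
  qed
  moreover have "(\<Inter>k. T a b c d (\<delta> k)) = {}"
  proof (rule ccontr)
    assume "\<not> ?thesis"
    then obtain z where z: "\<And>k. z \<in> T a b c d (\<delta> k)" by blast
    have "infdist z G \<le> 0" by (rule LIMSEQ_le_const[OF \<delta>0]) (use z in \<open>auto simp: T_def\<close>)
    then have "infdist z G = 0" using infdist_nonneg[of z G] by simp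
    then show False using in_closed_iff_infdist_zero[OF G Gne] z[of 0] by (simp add: T_def)
  qed
  ultimately have "(\<lambda>k. measure lborel (T a b c d (\<delta> k))) \<longlonglongrightarrow> 0" by simp
  from tendsto_mult_left[OF this, of \<kappa>]
  have "(\<lambda>k. \<kappa> * measure lborel (T a b c d (\<delta> k))) \<longlonglongrightarrow> 0" by simp
  then have "norm (rect_integral h a b c d) \<le> 0"
    by (rule LIMSEQ_le_const) (use main[OF R] R(3) in \<open>auto simp: \<delta>_def r_def\<close>)
  then show ?thesis by simp
qed

end

text \<open>
  A primitive is defined by integrating along the bottom side and then upwards. The vanishing of the
  rectangle integrals allows the other order of integration, so both partial derivatives are
  known, \<open>h\<close> and \<open>\<i> * h\<close>, and they are continuous and satisfy the Cauchy-Riemann equations.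
\<close>

lemma morera_rectangles:
  assumes cont: "continuous_on (cbox (Complex a c) (Complex b d)) h"
    and null: "\<And>a' b' c' d'. cbox (Complex a' c') (Complex b' d') \<subseteq> cbox (Complex a c) (Complex b d) \<Longrightarrow>
       a' \<le> b' \<Longrightarrow> c' \<le> d' \<Longrightarrow> rect_integral h a' b' c' d' = 0"
  shows "h holomorphic_on box (Complex a c) (Complex b d)"
proof -
  define \<Phi> where "\<Phi> x y = integral {a..x} (\<lambda>t. h (Complex t c)) + \<i> * integral {c..y} (\<lambda>s. h (Complex x s))" for x y
  have \<Phi>2: "\<Phi> x y = integral {a..x} (\<lambda>t. h (Complex t y)) + \<i> * integral {c..y} (\<lambda>s. h (Complex a s))"
    if xy: "x \<in> {a..b}" "y \<in> {c..d}" for x y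
  proof -
    have "rect_integral h a x c y = 0"
      by (rule null) (use xy in \<open>auto simp: in_cbox_complex_iff subset_iff\<close>)
    moreover have "(\<lambda>t. h (Complex t s)) integrable_on {a..x}" if "s \<in> {c..d}" for s
      by (intro integrable_continuous_real continuous_on_horizontal[OF cont that]) (use xy in auto)
    moreover have "(\<lambda>s. h (Complex t s)) integrable_on {c..y}" if "t \<in> {a..b}" for t
      by (intro integrable_continuous_real continuous_on_vertical[OF cont that]) (use xy in auto)
    ultimately show ?thesis using xy
      by (simp add: \<Phi>_def rect_integral_def integral_diff algebra_simps)
  qed
  have \<Phi>x: "((\<lambda>x. \<Phi> x y) has_vector_derivative h (Complex x y)) (at x within {a..b})"
    if xy: "x \<in> {a..b}" "y \<in> {c..d}" for x y
  proof -
    have "((\<lambda>x. integral {a..x} (\<lambda>t. h (Complex t y)) + \<i> * integral {c..y} (\<lambda>s. h (Complex a s))) has_vector_derivative h (Complex x y) + 0) (at x within {a..b})"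
      by (intro has_vector_derivative_add has_vector_derivative_const integral_has_vector_derivative continuous_on_horizontal[OF cont])
         (use xy in auto)
    then show ?thesis using xy by (auto intro: has_vector_derivative_transform[rotated 2] simp: \<Phi>2)
  qed
  have \<Phi>y: "((\<lambda>y. \<Phi> x y) has_vector_derivative \<i> * h (Complex x y)) (at y within {c..d})"
    if xy: "x \<in> {a..b}" "y \<in> {c..d}" for x y
  proof -
    have "((\<lambda>y. integral {a..x} (\<lambda>t. h (Complex t c)) + \<i> * integral {c..y} (\<lambda>s. h (Complex x s))) has_vector_derivative 0 + \<i> * h (Complex x y)) (at y within {c..d})"
      by (intro has_vector_derivative_add has_vector_derivative_const has_vector_derivative_mult_right
           integral_has_vector_derivative continuous_on_vertical[OF cont]) (use xy in auto)
    then show ?thesis by (simp add: \<Phi>_def)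
  qed
  have contP: "continuous_on ({a..b} \<times> {c..d}) (\<lambda>z. h (Complex (fst z) (snd z)))"
    by (rule continuous_on_compose2[OF cont]) (auto simp: Complex_eq in_cbox_complex_iff intro!: continuous_intros)
  have der: "((\<lambda>z. \<Phi> (Re z) (Im z)) has_field_derivative h z) (at z)" if z: "z \<in> box (Complex a c) (Complex b d)" for z
  proof -
    let ?x = "Re z" and ?y = "Im z"
    have xy: "?x \<in> {a<..<b}" "?y \<in> {c<..<d}" using z by (auto simp: in_box_complex_iff)
    have "((\<lambda>(x, y). \<Phi> x y) has_derivative (\<lambda>(tx, ty). tx *\<^sub>R h (Complex ?x ?y) + blinfun_apply (blinfun_scaleR_left (\<i> * h (Complex ?x ?y))) ty))
        (at (?x, ?y) within {a..b} \<times> {c..d})"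
    proof (rule has_derivative_partialsI)
      show "((\<lambda>x. \<Phi> x ?y) has_derivative (\<lambda>tx. tx *\<^sub>R h (Complex ?x ?y))) (at ?x within {a..b})"
        using \<Phi>x[of ?x ?y] xy by (simp add: has_vector_derivative_def)
      show "(\<Phi> x has_derivative blinfun_apply (blinfun_scaleR_left (\<i> * h (Complex x y)))) (at y within {c..d})"
        if "x \<in> {a..b}" "y \<in> {c..d}" for x y
        using \<Phi>y[OF that] by (simp add: has_vector_derivative_def)
      show "continuous (at (?x, ?y) within {a..b} \<times> {c..d}) (\<lambda>(x, y). blinfun_scaleR_left (\<i> * h (Complex x y)))"
      proof -
        have "continuous_on ({a..b} \<times> {c..d}) (\<lambda>(x, y). blinfun_scaleR_left (\<i> * h (Complex x y)))"
          unfolding case_prod_beta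
          by (intro bounded_linear.continuous_on[OF bounded_linear_blinfun_scaleR_left] continuous_intros contP)
        then show ?thesis using xy by (auto simp: continuous_on_eq_continuous_within)
      qed
    qed (use xy in auto)
    moreover have "at (?x, ?y) within {a..b} \<times> {c..d} = at (?x, ?y)"
      by (rule at_within_interior) (use xy in \<open>auto simp: interior_Times\<close>)
    ultimately have"((\<lambda>(x, y). \<Phi> x y) has_derivative (\<lambda>(tx, ty). tx *\<^sub>R h z + ty *\<^sub>R (\<i> * h z))) (at (?x, ?y))"
      by simp
    note 2 = this
    have 1: "((\<lambda>z. (Re z, Im z)) has_derivative (\<lambda>z. (Re z, Im z))) (at z)"
      by (auto intro!: derivative_eq_intros)
    have "((\<lambda>z. \<Phi> (Re z) (Im z)) has_derivative (\<lambda>t. Re t *\<^sub>R h z + Im t *\<^sub>R (\<i> * h z))) (at z)"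
      using diff_chain_at[OF 1 2] by (simp add: o_def)
    moreover have "(\<lambda>t. Re t *\<^sub>R h z + Im t *\<^sub>R (\<i> * h z)) = (*) (h z)"
      by (rule ext) (simp add: complex_eq_iff algebra_simps)
    ultimately show ?thesis by (simp add: has_field_derivative_def)
  qed
  have "(\<lambda>z. \<Phi> (Re z) (Im z)) holomorphic_on box (Complex a c) (Complex b d)"
    unfolding holomorphic_on_def field_differentiable_def using der has_field_derivative_at_within by blast
  then have "deriv (\<lambda>z. \<Phi> (Re z) (Im z)) holomorphic_on box (Complex a c) (Complex b d)"
    by (rule holomorphic_deriv) (rule open_box)
  then show ?thesis
    by (rule holomorphic_transform) (rule DERIV_imp_deriv[OF der])
qed

section \<open>The Looman-Menchoff theorem\<close>

lemma difference_bound_near: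
  fixes f :: "real \<Rightarrow> complex"
  assumes "(f has_vector_derivative D) (at x)"
  obtains \<delta> where "\<delta> > 0" "\<And>t. \<bar>t\<bar> < \<delta> \<Longrightarrow> norm (f (x + t) - f x) \<le> (norm D + 1) * \<bar>t\<bar>"
proof -
  have "(f has_derivative (\<lambda>t. t *\<^sub>R D)) (at x)" using assms by (simp add: has_vector_derivative_def)
  then obtain \<delta> where \<delta>: "\<delta> > 0"
    "\<And>y. norm (y - x) < \<delta> \<Longrightarrow> norm (f y - f x - (y - x) *\<^sub>R D) \<le> 1 * norm (y - x)"
    unfolding has_derivative_at_alt using zero_less_one by blast
  have "norm (f (x + t) - f x) \<le> (norm D + 1) * \<bar>t\<bar>" if t: "\<bar>t\<bar> < \<delta>" for t
  proof -
    have "norm (f (x + t) - f x) \<le> norm (f (x + t) - f x - t *\<^sub>R D) + norm (t *\<^sub>R D)"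
      using norm_triangle_ineq[of "f (x + t) - f x - t *\<^sub>R D" "t *\<^sub>R D"] by simp
    also have "\<dots> \<le> \<bar>t\<bar> + \<bar>t\<bar> * norm D" using \<delta>(2)[of "x + t"] t by simp
    finally show ?thesis by (simp add: algebra_simps)
  qed
  with \<delta>(1) show thesis by (rule that)
qed

text \<open>
  Let \<open>E\<close> be the set of points of \<open>U\<close> near which \<open>h\<close> is not holomorphic. Existence of the partial
  derivatives at a point bounds the difference quotients there for small steps, so \<open>E\<close> is covered
  near each of its points by the closed sets \<open>En n\<close>, on which a uniform bound holds, and by
  countably many points. By Baire's theorem one of these sets contains a nonempty relatively
  open part of \<open>E\<close>, and \<open>h\<close> turns out to be holomorphic near a point \<open>y\<close> of this part: if the part is a
  single point, the singularity is removable, and otherwise the rectangle integrals vanish and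
  Morera's theorem applies. This contradicts \<open>y \<in> E\<close>.
\<close>

theorem looman_menchoff:
  assumes U: "open U" "continuous_on U h"
    and bad: "countable {z\<in>U. \<not> partials_exist h z}"
    and ae: "AE z in lebesgue. z \<in> U \<longrightarrow> dbar h z = 0"
  shows "h holomorphic_on U"
proof -
  \<comment> \<open>\<open>A\<close> is the open set of points near which \<open>h\<close> is holomorphic.\<close>
  define A where "A = {z. \<exists>r>0. h holomorphic_on ball z r}"
  have A_I: "z \<in> A" if V: "open V" "z \<in> V" "h holomorphic_on V" for z V
  proof -
    obtain r where "r > 0" "ball z r \<subseteq> V" using openE[OF V(1,2)] .
    then show ?thesis unfolding A_def using holomorphic_on_subset[OF V(3)] by blast
  qed
  have A_D: "h field_differentiable at z" if "z \<in> A" for z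
    using that unfolding A_def by (auto simp: holomorphic_on_imp_differentiable_at[OF _ open_ball])
  have "open A"
    unfolding open_contains_ball
  proof
    fix z assume "z \<in> A"
    then obtain r where r: "r > 0" "h holomorphic_on ball z r" by (auto simp: A_def)
    then have "ball z r \<subseteq> A" using A_I[OF open_ball _ r(2)] by blast
    then show "\<exists>e>0. ball z e \<subseteq> A" using r by blast
  qed
  define E where "E = U - A"
  have "E = {}"
  proof (rule ccontr)
    assume "E \<noteq> {}"
    then obtain p where p: "p \<in> E" by blast
    then have "p \<in> U" by (simp add: E_def)
    then obtain R where R: "R > 0" "cball p R \<subseteq> U" using U(1) open_contains_cball[of U] by blast
    define r where "r = R / 2"
    have r: "r > 0" "cball p (r + r) \<subseteq> U" using R by (auto simp: r_def)
    \<comment> \<open>Baire's theorem needs a closed set. In this closure, every relatively open part meets \<open>E\<close>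
        inside the open ball.\<close>
    define S where "S = closure (E \<inter> ball p r)"
    have S_cball: "S \<subseteq> cball p r"
      unfolding S_def by (rule closure_minimal) auto
    have SU: "S \<subseteq> U" using S_cball r by (auto simp: subset_iff)
    have pS: "p \<in> S" unfolding S_def using p r closure_subset by fastforce
    define En where "En n = {z \<in> cball p r. \<forall>t. \<bar>t\<bar> \<le> r / real (Suc n) \<longrightarrow>
        norm (h (z + complex_of_real t) - h z) \<le> real n * \<bar>t\<bar> \<and>
        norm (h (z + complex_of_real t * \<i>) - h z) \<le> real n * \<bar>t\<bar>}" for n
    have En_closed: "closed (En n)" for n
    proof -
      have shift: "continuous_on (cball p r) (\<lambda>z. h (z + w))" if "norm w \<le> r" for w
      proof (rule continuous_on_compose2[OF U(2)])
        show "(\<lambda>z. z + w) ` cball p r \<subseteq> U"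
        proof (rule order.trans[OF _ r(2)], clarify)
          fix z assume "z \<in> cball p r"
          then have "norm (p - (z + w)) \<le> r + r"
            using that norm_triangle_ineq4[of "p - z" w] by (simp add: dist_norm algebra_simps)
          then show "z + w \<in> cball p (r + r)" by (simp add: dist_norm)
        qed
      qed (intro continuous_intros)
      have *: "closed {z \<in> cball p r. norm (h (z + w) - h z) \<le> K}" if "norm w \<le> r" for w K
        by (rule continuous_on_closed_Collect_le)
           (use shift[OF that] shift[of 0] r in \<open>auto intro!: continuous_intros\<close>)
      have "En n = cball p r \<inter> (\<Inter>t\<in>{- (r / real (Suc n))..r / real (Suc n)}.
          {z \<in> cball p r. norm (h (z + complex_of_real t) - h z) \<le> real n * \<bar>t\<bar>} \<inter>
          {z \<in> cball p r. norm (h (z + complex_of_real t * \<i>) - h z) \<le> real n * \<bar>t\<bar>})"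
        unfolding En_def by (auto simp: abs_le_iff)
      also have "closed \<dots>"
      proof (intro closed_Int closed_INT ballI * closed_cball)
        fix t assume t: "t \<in> {- (r / real (Suc n))..r / real (Suc n)}"
        have "r / real (Suc n) \<le> r" using r by (simp add: divide_le_eq)
        then show "norm (complex_of_real t) \<le> r" "norm (complex_of_real t * \<i>) \<le> r"
          using t by (auto simp: norm_mult)
      qed
      finally show ?thesis .
    qed
    define Bad where "Bad = {z\<in>U. \<not> partials_exist h z}"
    have cover: "\<exists>n. z \<in> En n" if z: "z \<in> S" "z \<notin> Bad" for z
    proof -
      have "partials_exist h z" using z SU by (auto simp: Bad_def)
      then obtain d1 d2 where d1: "((\<lambda>t. h (Complex t (Im z))) has_vector_derivative d1) (at (Re z))"
        and d2: "((\<lambda>t. h (Complex (Re z) t)) has_vector_derivative d2) (at (Im z))"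
        by (auto simp: partials_exist_def has_dx_def has_dy_def)
      obtain \<delta>1 where \<delta>1: "\<delta>1 > 0"
        "\<And>t. \<bar>t\<bar> < \<delta>1 \<Longrightarrow> norm (h (Complex (Re z + t) (Im z)) - h (Complex (Re z) (Im z))) \<le> (norm d1 + 1) * \<bar>t\<bar>"
        using difference_bound_near[OF d1] by blast
      obtain \<delta>2 where \<delta>2: "\<delta>2 > 0"
        "\<And>t. \<bar>t\<bar> < \<delta>2 \<Longrightarrow> norm (h (Complex (Re z) (Im z + t)) - h (Complex (Re z) (Im z))) \<le> (norm d2 + 1) * \<bar>t\<bar>"
        using difference_bound_near[OF d2] by blast
      obtain n where n: "real n > max (max (norm d1 + 1) (norm d2 + 1)) (r / min \<delta>1 \<delta>2)"
        using reals_Archimedean2 by blast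
      have small: "r / real (Suc n) < \<delta>1" "r / real (Suc n) < \<delta>2"
      proof -
        have m: "min \<delta>1 \<delta>2 > 0" using \<delta>1 \<delta>2 by simp
        have "r / min \<delta>1 \<delta>2 < real (Suc n)" using n by simp
        then have "r < real (Suc n) * min \<delta>1 \<delta>2" by (simp only: pos_divide_less_eq[OF m])
        moreover have "real (Suc n) > 0" by simp
        ultimately have "r / real (Suc n) < min \<delta>1 \<delta>2" by (simp only: pos_divide_less_eq mult.commute)
        then show "r / real (Suc n) < \<delta>1" "r / real (Suc n) < \<delta>2" by auto
      qed
      have "z \<in> En n" unfolding En_def
      proof (intro CollectI conjI allI impI)
        show "z \<in> cball p r" using z S_cball by blast
        fix t assume t: "\<bar>t\<bar> \<le> r / real (Suc n)"
        have "Complex (Re z + t) (Im z) = z + complex_of_real t" "Complex (Re z) (Im z + t) = z + complex_of_real t * \<i>"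
          "Complex (Re z) (Im z) = z" by (simp_all add: complex_eq_iff)
        note eq = this
        have "norm (h (z + complex_of_real t) - h z) \<le> (norm d1 + 1) * \<bar>t\<bar>"
          using \<delta>1(2)[of t] small t unfolding eq by linarith
        also have "\<dots> \<le> real n * \<bar>t\<bar>" using n by (intro mult_right_mono) auto
        finally show "norm (h (z + complex_of_real t) - h z) \<le> real n * \<bar>t\<bar>" .
        have "norm (h (z + complex_of_real t * \<i>) - h z) \<le> (norm d2 + 1) * \<bar>t\<bar>"
          using \<delta>2(2)[of t] small t unfolding eq by linarith
        also have "\<dots> \<le> real n * \<bar>t\<bar>" using n by (intro mult_right_mono) auto
        finally show "norm (h (z + complex_of_real t * \<i>) - h z) \<le> real n * \<bar>t\<bar>" .
      qed
      then show ?thesis ..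
    qed
    define \<C> where "\<C> = range En \<union> (\<lambda>z. {z}) ` Bad"
    have "\<exists>C\<in>\<C>. \<not> S \<subseteq> closure (S - C)"
    proof (rule ccontr)
      assume "\<not> ?thesis"
      then have dense: "S \<subseteq> closure (S - C)" if "C \<in> \<C>" for C using that by blast
      have "S \<subseteq> closure (\<Inter>((\<lambda>C. S - C) ` \<C>))"
      proof (rule Baire)
        show "closed S" by (simp add: S_def)
        show "countable ((\<lambda>C. S - C) ` \<C>)" using bad unfolding \<C>_def Bad_def by (intro countable_image countable_Un) auto
        fix T assume "T \<in> (\<lambda>C. S - C) ` \<C>"
        then obtain C where C: "C \<in> \<C>" "T = S - C" by blast
        then have "closed C" using En_closed by (auto simp: \<C>_def)
        then have "openin (top_of_set S) T" unfolding C(2) Diff_eq by (intro openin_open_Int) auto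
        then show "openin (top_of_set S) T \<and> S \<subseteq> closure T" using dense C by simp
      qed
      moreover have "\<Inter>((\<lambda>C. S - C) ` \<C>) = {}"
      proof (rule ccontr)
        assume "\<not> ?thesis"
        then obtain z where z: "\<And>C. C \<in> \<C> \<Longrightarrow> z \<in> S - C" by blast
        from z[of "En 0"] have "z \<in> S" by (simp add: \<C>_def)
        moreover have "z \<notin> Bad" using z[of "{z}"] by (auto simp: \<C>_def)
        ultimately obtain n where "z \<in> En n" using cover by blast
        then show False using z[of "En n"] by (auto simp: \<C>_def)
      qed
      ultimately show False using pS by simp
    qed
    then obtain C x where C: "C \<in> \<C>" and x: "x \<in> S" "x \<notin> closure (S - C)" by blast
    define W where "W = (- closure (S - C)) \<inter> ball p r"
    have W: "open W" unfolding W_def by (intro open_Int) auto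
    have WU: "W \<subseteq> U" using r by (auto simp: W_def subset_iff)
    have WE: "W \<inter> E \<subseteq> C"
    proof
      fix z assume z: "z \<in> W \<inter> E"
      then have "z \<in> S" unfolding S_def W_def using closure_subset by fastforce
      then show "z \<in> C" using z closure_subset[of "S - C"] by (auto simp: W_def)
    qed
    have "(- closure (S - C)) \<inter> closure (E \<inter> ball p r) \<noteq> {}" using x unfolding S_def by blast
    then have "(- closure (S - C)) \<inter> (E \<inter> ball p r) \<noteq> {}"
      using open_Int_closure_eq_empty[of "- closure (S - C)" "E \<inter> ball p r"] by auto
    then obtain y where y: "y \<in> W" "y \<in> E" unfolding W_def by blast
    from C consider (single) z where "C = {z}" | (lip) n where "C = En n" by (auto simp: \<C>_def)
    then have "y \<in> A"
    proof cases
      case single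
      have "h holomorphic_on W - {y}"
        unfolding holomorphic_on_def
      proof
        fix z assume z: "z \<in> W - {y}"
        then have "z \<notin> E" using WE y single by auto
        then have "z \<in> A" using z WU by (auto simp: E_def)
        then show "h field_differentiable at z within (W - {y})"
          using A_D field_differentiable_at_within by blast
      qed
      then have "h holomorphic_on W"
        using no_isolated_singularity[of W h "{y}"] continuous_on_subset[OF U(2) WU] W by simp
      then show ?thesis using A_I W y by blast
    next
      case (lip n)
      define \<rho> where "\<rho> = r / real (Suc n)"
      have \<rho>: "\<rho> > 0" using r by (simp add: \<rho>_def)
      obtain e where e: "e > 0" "ball y e \<subseteq> W" using openE[OF W y(1)] .
      \<comment> \<open>The square of half side \<open>\<delta>\<close> about \<open>y\<close> must lie in \<open>W\<close> and have side at most \<open>\<rho>\<close>.\<close>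
      define \<delta> where "\<delta> = min (e / 3) (\<rho> / 2)"
      have \<delta>: "\<delta> > 0" "\<delta> \<le> e / 3" "2 * \<delta> \<le> \<rho>" using e \<rho> by (auto simp: \<delta>_def)
      define a b c d where "a = Re y - \<delta>" and "b = Re y + \<delta>" and "c = Im y - \<delta>" and "d = Im y + \<delta>"
      define Q where "Q = cbox (Complex a c) (Complex b d)"
      have QW: "Q \<subseteq> W"
      proof
        fix z assume "z \<in> Q"
        then have "\<bar>Re (y - z)\<bar> \<le> \<delta>" "\<bar>Im (y - z)\<bar> \<le> \<delta>"
          by (auto simp: Q_def in_cbox_complex_iff a_def b_def c_def d_def)
        then have "norm (y - z) \<le> \<delta> + \<delta>" using cmod_le[of "y - z"] by linarith
        then have "dist y z < e" using \<delta> e by (simp add: dist_norm)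
        then show "z \<in> W" using e by auto
      qed
      define F where "F = E \<inter> Q"
      have "F = Q \<inter> - A" using QW WU by (auto simp: F_def E_def)
      then have Fc: "compact F" using \<open>open A\<close> unfolding Q_def by (auto intro: compact_Int_closed)
      have F_En: "F \<subseteq> En n" using WE QW lip by (auto simp: F_def)
      have FU: "F \<subseteq> U" by (auto simp: F_def E_def)
      interpret thin_singular_set h U Q F Bad "real n" \<rho>
      proof
        show "h field_differentiable at z" if "z \<in> Q - F" for z
          using that QW WU by (intro A_D) (auto simp: F_def E_def)
        show "norm (h (z + complex_of_real t) - h z) \<le> real n * \<bar>t\<bar>"
          "norm (h (z + complex_of_real t * \<i>) - h z) \<le> real n * \<bar>t\<bar>" if "z \<in> F" "\<bar>t\<bar> \<le> \<rho>" for z t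
          using that F_En unfolding En_def \<rho>_def by blast+
        show "AE z in lebesgue. z \<in> F \<longrightarrow> dbar h z = 0" using ae by eventually_elim (use FU in auto)
      qed (use U Fc FU QW WU \<rho> bad in \<open>auto simp: Bad_def\<close>)
      have "h holomorphic_on box (Complex a c) (Complex b d)"
      proof (rule morera_rectangles)
        show "continuous_on (cbox (Complex a c) (Complex b d)) h"
          using continuous_on_subset[OF U(2)] QW WU unfolding Q_def by blast
        fix a' b' c' d'
        assume R: "cbox (Complex a' c') (Complex b' d') \<subseteq> cbox (Complex a c) (Complex b d)" "a' \<le> b'" "c' \<le> d'"
        show "rect_integral h a' b' c' d' = 0"
        proof (cases "a' < b' \<and> c' < d'")
          case True
          have "Complex a' c' \<in> cbox (Complex a c) (Complex b d)" "Complex b' d' \<in> cbox (Complex a c) (Complex b d)"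
            by (intro subsetD[OF R(1)]; simp add: in_cbox_complex_iff R(2,3))+
          then have "b' - a' \<le> 2 * \<delta>" "d' - c' \<le> 2 * \<delta>"
            by (auto simp: in_cbox_complex_iff a_def b_def c_def d_def)
          then show ?thesis using True R \<delta> by (intro rect_integral_null) (auto simp: Q_def)
        next
          case False
          then have "box (Complex a' c') (Complex b' d') = {}" by (auto simp: in_box_complex_iff)
          then show ?thesis using R by (intro rect_integral_disjoint) (auto simp: Q_def)
        qed
      qed
      moreover have "y \<in> box (Complex a c) (Complex b d)"
        using \<delta> by (simp add: in_box_complex_iff a_def b_def c_def d_def)
      ultimately show ?thesis using A_I open_box by blast
    qed
    then show False using y by (simp add: E_def)
  qed
  then have "U \<subseteq> A" by (auto simp: E_def)
  show ?thesis
    unfolding holomorphic_on_def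
  proof
    fix z assume "z \<in> U"
    with \<open>U \<subseteq> A\<close> show "h field_differentiable at z within U"
      by (intro field_differentiable_at_within[OF A_D]) blast
  qed
qed

section \<open>Calculus of the classes of k times continuously differentiable functions\<close>

lemma has_dx_cong:
  assumes "open S" "z \<in> S" "\<And>w. w \<in> S \<Longrightarrow> u w = v w"
  shows "has_dx u d z \<longleftrightarrow> has_dx v d z"
proof -
  have V: "open ((\<lambda>t. Complex t (Im z)) -` S)"
    by (rule open_vimage[OF assms(1)]) (auto simp: Complex_eq intro!: continuous_intros)
  have imp: "has_dx v d z" if "has_dx u d z" "\<And>w. w \<in> S \<Longrightarrow> u w = v w" for u v
    using that(1) unfolding has_dx_def
    by (rule has_vector_derivative_transform_within_open[OF _ V]) (use assms(2) that(2) in auto)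
  show ?thesis using imp[of u v] imp[of v u] assms(3) by auto
qed

lemma has_dy_cong:
  assumes "open S" "z \<in> S" "\<And>w. w \<in> S \<Longrightarrow> u w = v w"
  shows "has_dy u d z \<longleftrightarrow> has_dy v d z"
proof -
  have V: "open ((\<lambda>t. Complex (Re z) t) -` S)"
    by (rule open_vimage[OF assms(1)]) (auto simp: Complex_eq intro!: continuous_intros)
  have imp: "has_dy v d z" if "has_dy u d z" "\<And>w. w \<in> S \<Longrightarrow> u w = v w" for u v
    using that(1) unfolding has_dy_def
    by (rule has_vector_derivative_transform_within_open[OF _ V]) (use assms(2) that(2) in auto)
  show ?thesis using imp[of u v] imp[of v u] assms(3) by auto
qed

lemma partials_cong:
  assumes "open S" "z \<in> S" "\<And>w. w \<in> S \<Longrightarrow> u w = v w"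
  shows "dx u z = dx v z" "dy u z = dy v z" "partials_exist u z \<longleftrightarrow> partials_exist v z"
  using has_dx_cong[OF assms] has_dy_cong[OF assms] by (simp_all add: dx_def dy_def partials_exist_def)

lemma Ck_on_cong:
  assumes "open S" "\<And>w. w \<in> S \<Longrightarrow> u w = v w"
  shows "Ck_on k S u \<longleftrightarrow> Ck_on k S v"
  using assms(2)
proof (induction k arbitrary: u v)
  case 0
  then show ?case using continuous_on_cong[of S S u v] by simp
next
  case (Suc k)
  have "Ck_on k S (dx u) \<longleftrightarrow> Ck_on k S (dx v)" "Ck_on k S (dy u) \<longleftrightarrow> Ck_on k S (dy v)"
    by (rule Suc.IH; use partials_cong[OF assms(1) _ Suc.prems] in auto)+
  moreover have "continuous_on S u \<longleftrightarrow> continuous_on S v" using Suc.prems continuous_on_cong[of S S u v] by simp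
  moreover have "(\<forall>z\<in>S. partials_exist u z) \<longleftrightarrow> (\<forall>z\<in>S. partials_exist v z)"
    using partials_cong(3)[OF assms(1) _ Suc.prems] by auto
  ultimately show ?case by simp
qed

lemma Ck_on_subset: "Ck_on k S v \<Longrightarrow> T \<subseteq> S \<Longrightarrow> Ck_on k T v"
  by (induction k arbitrary: v) (auto intro: continuous_on_subset)

lemma Ck_on_imp_continuous_on: "Ck_on k S v \<Longrightarrow> continuous_on S v"
  by (cases k) auto

lemma Ck_on_Suc_imp: "Ck_on (Suc k) S v \<Longrightarrow> Ck_on k S v"
proof (induction k arbitrary: v)
  case (Suc k)
  have "continuous_on S v" "\<forall>z\<in>S. partials_exist v z" "Ck_on (Suc k) S (dx v)" "Ck_on (Suc k) S (dy v)"
    using Suc.prems unfolding Ck_on.simps(2)[of "Suc k"] by blast+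
  then show ?case using Suc.IH[of "dx v"] Suc.IH[of "dy v"] unfolding Ck_on.simps(2)[of k S v] by blast
qed simp

text \<open>
  Needed because the solution is expressed through \<open>G\<close> only locally, on neighbourhoods that do not depend
  on the order of differentiation.
\<close>

lemma Ck_on_local:
  assumes "\<And>z. z \<in> S \<Longrightarrow> \<exists>T. open T \<and> z \<in> T \<and> Ck_on k T v"
  shows "Ck_on k S v"
  using assms
proof (induction k arbitrary: v)
  case 0
  show ?case
    unfolding Ck_on.simps
  proof (rule continuous_at_imp_continuous_on, rule ballI)
    fix z assume "z \<in> S"
    then obtain T where T: "open T" "z \<in> T" "continuous_on T v" using "0.prems" by auto
    then show "isCont v z" using continuous_on_eq_continuous_at[OF T(1), of v] by simp
  qed
next
  case (Suc k)
  have T: "\<exists>T. open T \<and> z \<in> T \<and> continuous_on T v \<and> (\<forall>z\<in>T. partials_exist v z) \<and> Ck_on k T (dx v) \<and> Ck_on k T (dy v)"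
    if "z \<in> S" for z using Suc.prems[OF that] by simp
  have "continuous_on S v"
  proof (rule continuous_at_imp_continuous_on, rule ballI)
    fix z assume "z \<in> S"
    then obtain T where T: "open T" "z \<in> T" "continuous_on T v" using T by blast
    then show "isCont v z" using continuous_on_eq_continuous_at[OF T(1), of v] by simp
  qed
  moreover have "Ck_on k S (dx v)" by (rule Suc.IH) (use T in blast)
  moreover have "Ck_on k S (dy v)" by (rule Suc.IH) (use T in blast)
  moreover have "\<forall>z\<in>S. partials_exist v z" using T by blast
  ultimately show ?case by simp
qed

lemma partials_exist_iff: "partials_exist v z \<longleftrightarrow> has_dx v (dx v z) z \<and> has_dy v (dy v z) z"
  unfolding partials_exist_def by (auto dest: has_dx_imp_dx has_dy_imp_dy)

lemma partials_const:
  "has_dx (\<lambda>_. c) 0 z" "has_dy (\<lambda>_. c) 0 z"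
  by (auto simp: has_dx_def has_dy_def)

lemma Ck_on_const: "Ck_on k S (\<lambda>_. c)"
proof (induction k arbitrary: c)
  case (Suc k)
  have "dx (\<lambda>_. c) = (\<lambda>_. 0)" "dy (\<lambda>_. c) = (\<lambda>_. 0)" "partials_exist (\<lambda>_. c) z" for z
    using partials_const has_dx_imp_dx[OF partials_const(1)] has_dy_imp_dy[OF partials_const(2)]
    by (auto simp: partials_exist_def fun_eq_iff intro: exI[of _ 0])
  then show ?case using Suc.IH[of 0] by simp
qed simp

lemma partials_id: "has_dx (\<lambda>z. z) 1 z" "has_dy (\<lambda>z. z) \<i> z"
  by (auto simp: has_dx_def has_dy_def Complex_eq intro!: derivative_eq_intros)

lemma Ck_on_id: "Ck_on k S (\<lambda>z. z)"
proof (cases k)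
  case (Suc m)
  have "dx (\<lambda>z. z) = (\<lambda>_. 1)" "dy (\<lambda>z. z) = (\<lambda>_. \<i>)" "partials_exist (\<lambda>z. z) z" for z
    using partials_id has_dx_imp_dx[OF partials_id(1)] has_dy_imp_dy[OF partials_id(2)]
    by (auto simp: partials_exist_def fun_eq_iff)
  then show ?thesis using Suc Ck_on_const by (simp add: continuous_on_id)
qed (simp add: continuous_on_id)

lemma partials_add:
  assumes "partials_exist u z" "partials_exist v z"
  shows "has_dx (\<lambda>z. u z + v z) (dx u z + dx v z) z" "has_dy (\<lambda>z. u z + v z) (dy u z + dy v z) z"
  using assms unfolding partials_exist_iff has_dx_def has_dy_def by (auto intro: has_vector_derivative_add)

lemma partials_mult:
  assumes "partials_exist u z" "partials_exist v z"
  shows "has_dx (\<lambda>z. u z * v z) (u z * dx v z + dx u z * v z) z"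
    "has_dy (\<lambda>z. u z * v z) (u z * dy v z + dy u z * v z) z"
  using assms has_vector_derivative_mult[of "\<lambda>t. u (Complex t (Im z))" "dx u z" "Re z" UNIV "\<lambda>t. v (Complex t (Im z))" "dx v z"]
    has_vector_derivative_mult[of "\<lambda>t. u (Complex (Re z) t)" "dy u z" "Im z" UNIV "\<lambda>t. v (Complex (Re z) t)" "dy v z"]
  unfolding partials_exist_iff has_dx_def has_dy_def by auto

lemma partials_compose:
  assumes "partials_exist u z" and "(\<phi> has_field_derivative D) (at (u z))"
  shows "has_dx (\<lambda>z. \<phi> (u z)) (D * dx u z) z" "has_dy (\<lambda>z. \<phi> (u z)) (D * dy u z) z"
  using assms field_vector_diff_chain_at[of "\<lambda>t. u (Complex t (Im z))" "dx u z" "Re z" \<phi> D]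
    field_vector_diff_chain_at[of "\<lambda>t. u (Complex (Re z) t)" "dy u z" "Im z" \<phi> D]
  unfolding partials_exist_iff has_dx_def has_dy_def by (auto simp: o_def mult.commute)

lemma Ck_on_SucI:
  assumes S: "open S" and "continuous_on S v"
    and d: "\<And>z. z \<in> S \<Longrightarrow> has_dx v (a z) z" "\<And>z. z \<in> S \<Longrightarrow> has_dy v (b z) z"
    and "Ck_on k S a" "Ck_on k S b"
  shows "Ck_on (Suc k) S v"
proof -
  have "dx v z = a z" "dy v z = b z" if "z \<in> S" for z
    by (rule has_dx_imp_dx[OF d(1)[OF that]], rule has_dy_imp_dy[OF d(2)[OF that]])
  then have "Ck_on k S (dx v) \<longleftrightarrow> Ck_on k S a" "Ck_on k S (dy v) \<longleftrightarrow> Ck_on k S b"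
    by (auto intro!: Ck_on_cong[OF S])
  then show ?thesis using assms by (auto simp: partials_exist_def)
qed

lemma Ck_on_add:
  assumes "open S"
  shows "Ck_on k S u \<Longrightarrow> Ck_on k S v \<Longrightarrow> Ck_on k S (\<lambda>z. u z + v z)"
proof (induction k arbitrary: u v)
  case (Suc k)
  show ?case
    by (rule Ck_on_SucI[OF assms _ partials_add]) (use Suc in \<open>auto intro: continuous_intros\<close>)
qed (auto intro: continuous_intros)

lemma Ck_on_mult:
  assumes "open S"
  shows "Ck_on k S u \<Longrightarrow> Ck_on k S v \<Longrightarrow> Ck_on k S (\<lambda>z. u z * v z)"
proof (induction k arbitrary: u v)
  case (Suc k)
  have "Ck_on k S u" "Ck_on k S v" by (rule Ck_on_Suc_imp[OF Suc.prems(1)], rule Ck_on_Suc_imp[OF Suc.prems(2)])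
  then show ?case
    by (intro Ck_on_SucI[OF assms _ partials_mult] Ck_on_add[OF assms] Suc.IH)
       (use Suc.prems in \<open>auto intro: continuous_intros\<close>)
qed (auto intro: continuous_intros)

text \<open>
  The partial derivatives of the composition are products of \<open>deriv \<phi> \<circ> u\<close>, to which the induction
  hypothesis applies because \<open>deriv \<phi>\<close> is again holomorphic, with those of \<open>u\<close>. This is
  why the induction is over all holomorphic \<open>\<phi>\<close>.
\<close>

lemma Ck_on_compose_holomorphic:
  assumes S: "open S" and T: "open T" and u: "u ` S \<subseteq> T"
  shows "\<phi> holomorphic_on T \<Longrightarrow> Ck_on k S u \<Longrightarrow> Ck_on k S (\<lambda>z. \<phi> (u z))"
proof (induction k arbitrary: \<phi>)
  case 0
  then show ?case using continuous_on_compose2[OF holomorphic_on_imp_continuous_on _ u] by simp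
next
  case (Suc k)
  have d: "(\<phi> has_field_derivative deriv \<phi> (u z)) (at (u z))" if "z \<in> S" for z
    using holomorphic_derivI[OF Suc.prems(1) T] u that by blast
  have "Ck_on k S (\<lambda>z. deriv \<phi> (u z))"
    using Suc.IH[OF holomorphic_deriv[OF Suc.prems(1) T]] Ck_on_Suc_imp[OF Suc.prems(2)] by blast
  then show ?case
    using Suc.prems(2) d
    by (intro Ck_on_SucI[OF S _ partials_compose] Ck_on_mult[OF S]
         continuous_on_compose2[OF holomorphic_on_imp_continuous_on[OF Suc.prems(1)] _ u]) auto
qed

section \<open>Double power series and real analyticity\<close>

definition monomial :: "complex \<Rightarrow> complex \<Rightarrow> nat \<times> nat \<Rightarrow> complex" where
  "monomial z0 z p = of_real (Re z - Re z0) ^ fst p * of_real (Im z - Im z0) ^ snd p"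

definition square :: "complex \<Rightarrow> real \<Rightarrow> complex set" where
  "square z0 \<rho> = {z. \<bar>Re z - Re z0\<bar> \<le> \<rho> \<and> \<bar>Im z - Im z0\<bar> \<le> \<rho>}"

text \<open>
  On the closed square of half side \<open>\<rho>\<close> about \<open>z0\<close>, \<open>v\<close> is the sum of a double power series whose
  weighted \<open>l\<^sup>1\<close> norm is at most \<open>M\<close>. The weight makes the series absolutely convergent on the
  whole square and the norm submultiplicative.
\<close>

definition series_norm_le :: "complex \<Rightarrow> real \<Rightarrow> (complex \<Rightarrow> complex) \<Rightarrow> real \<Rightarrow> bool" where
  "series_norm_le z0 \<rho> v M \<longleftrightarrow> (\<exists>a L. L \<le> M \<and> ((\<lambda>p. norm (a p) * \<rho> ^ (fst p + snd p)) has_sum L) UNIV \<and>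
     (\<forall>z\<in>square z0 \<rho>. ((\<lambda>p. a p * monomial z0 z p) has_sum v z) UNIV))"

lemma norm_monomial_le:
  assumes "z \<in> square z0 \<rho>"
  shows "norm (monomial z0 z p) \<le> \<rho> ^ (fst p + snd p)"
proof -
  have "norm (of_real (Re z - Re z0) :: complex) \<le> \<rho>" "norm (of_real (Im z - Im z0) :: complex) \<le> \<rho>" "0 \<le> \<rho>"
    using assms unfolding square_def norm_of_real by auto
  then show ?thesis
    unfolding monomial_def norm_mult norm_power power_add by (intro mult_mono power_mono) auto
qed

lemma summable_on_norm_bound:
  fixes f :: "'i \<Rightarrow> complex"
  assumes "g summable_on A" "\<And>x. x \<in> A \<Longrightarrow> norm (f x) \<le> g x"
  shows "f summable_on A"
  by (rule abs_summable_summable, rule summable_on_comparison_test[OF assms(1)]) (use assms(2) in auto)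

text \<open>
  The source of all closure properties below. Sums, products and infinite sums of double series all
  arise as families of monomials over a larger index set; collecting the
  coefficients of equal monomials can only decrease the weighted norm.
\<close>

lemma series_norm_le_regroup:
  fixes F :: "'i \<Rightarrow> complex" and \<pi> :: "'i \<Rightarrow> nat \<times> nat"
  assumes \<rho>: "0 < \<rho>"
    and w: "((\<lambda>i. norm (F i) * \<rho> ^ (fst (\<pi> i) + snd (\<pi> i))) has_sum L) UNIV"
    and rep: "\<And>z. z \<in> square z0 \<rho> \<Longrightarrow> ((\<lambda>i. F i * monomial z0 z (\<pi> i)) has_sum v z) UNIV"
    and L: "L \<le> M"
  shows "series_norm_le z0 \<rho> v M"
proof -
  define fib where "fib p = {i. \<pi> i = p}" for p
  define c where "c p = infsum F (fib p)" for p
  have bij: "bij_betw (\<lambda>i. (\<pi> i, i)) UNIV (Sigma UNIV fib)"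
    by (rule bij_betw_byWitness[where f' = snd]) (auto simp: fib_def)
  have split: "((\<lambda>(p, i). f i) has_sum s) (Sigma UNIV fib)" if "(f has_sum s) UNIV"
    for f :: "'i \<Rightarrow> 'c::topological_comm_monoid_add" and s
    using has_sum_reindex_bij_betw[OF bij, of "\<lambda>(p, i). f i" s] that by simp
  let ?W = "\<lambda>i. norm (F i) * \<rho> ^ (fst (\<pi> i) + snd (\<pi> i))"
  let ?g = "\<lambda>p. infsum ?W (fib p)"
  have Wf: "?W summable_on fib p" for p
    by (rule summable_on_subset_banach[of _ UNIV]) (use w in \<open>auto simp: summable_on_def\<close>)
  have g: "(?g has_sum L) UNIV"
    by (rule has_sum_SigmaD[OF split[OF w]]) (use Wf in auto)
  have c_le: "norm (c p) * \<rho> ^ (fst p + snd p) \<le> ?g p" for p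
  proof -
    have W_eq: "?W i = norm (F i * of_real \<rho> ^ (fst p + snd p))" if "i \<in> fib p" for i
      using that \<rho> by (simp add: fib_def norm_mult norm_power)
    have "norm (c p) * \<rho> ^ (fst p + snd p) = norm (infsum (\<lambda>i. F i * of_real \<rho> ^ (fst p + snd p)) (fib p))"
      unfolding c_def using \<rho> by (simp add: infsum_cmult_left' norm_mult norm_power)
    also have "\<dots> \<le> infsum (\<lambda>i. norm (F i * of_real \<rho> ^ (fst p + snd p))) (fib p)"
      by (rule norm_infsum_bound) (use Wf[of p] W_eq in \<open>simp cong: summable_on_cong\<close>)
    also have "\<dots> = ?g p" using W_eq by (intro infsum_cong) simp
    finally show ?thesis .
  qed
  have cs: "(\<lambda>p. norm (c p) * \<rho> ^ (fst p + snd p)) summable_on UNIV"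
    by (rule summable_on_comparison_test[of ?g]) (use g c_le \<rho> in \<open>auto simp: summable_on_def\<close>)
  then obtain L' where L': "((\<lambda>p. norm (c p) * \<rho> ^ (fst p + snd p)) has_sum L') UNIV"
    by (auto simp: summable_on_def)
  have "L' \<le> L" by (rule has_sum_mono[OF L' g c_le])
  moreover have "((\<lambda>p. c p * monomial z0 z p) has_sum v z) UNIV" if z: "z \<in> square z0 \<rho>" for z
  proof (rule has_sum_SigmaD[OF split[OF rep[OF z]]])
    fix p
    have "(\<lambda>i. F i * monomial z0 z (\<pi> i)) summable_on fib p"
      by (rule summable_on_subset_banach[of _ UNIV]) (use rep[OF z] in \<open>auto simp: summable_on_def\<close>)
    then have "((\<lambda>i. F i * monomial z0 z (\<pi> i)) has_sum infsum (\<lambda>i. F i * monomial z0 z (\<pi> i)) (fib p)) (fib p)"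
      by (rule has_sum_infsum)
    also have "infsum (\<lambda>i. F i * monomial z0 z (\<pi> i)) (fib p) = infsum (\<lambda>i. F i * monomial z0 z p) (fib p)"
      by (rule infsum_cong) (simp add: fib_def)
    also have "\<dots> = c p * monomial z0 z p" by (simp add: c_def infsum_cmult_left')
    finally show "((\<lambda>i. case (p, i) of (p, i) \<Rightarrow> F i * monomial z0 z (\<pi> i)) has_sum c p * monomial z0 z p) (fib p)"
      by simp
  qed
  ultimately show ?thesis unfolding series_norm_le_def using L' L by (intro exI[of _ c] exI[of _ L']) auto
qed

lemma series_norm_le_infsum:
  fixes f :: "'k \<Rightarrow> complex \<Rightarrow> complex"
  assumes \<rho>: "0 < \<rho>" and f: "\<And>k. series_norm_le z0 \<rho> (f k) (M k)"
    and M: "(M has_sum S) UNIV"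
    and v: "\<And>z. z \<in> square z0 \<rho> \<Longrightarrow> ((\<lambda>k. f k z) has_sum v z) UNIV"
  shows "series_norm_le z0 \<rho> v S"
proof -
  have "\<forall>k. \<exists>q. snd q \<le> M k \<and> ((\<lambda>p. norm (fst q p) * \<rho> ^ (fst p + snd p)) has_sum snd q) UNIV \<and>
      (\<forall>z\<in>square z0 \<rho>. ((\<lambda>p. fst q p * monomial z0 z p) has_sum f k z) UNIV)"
  proof
    fix k
    from f[of k] obtain a L where "L \<le> M k" "((\<lambda>p. norm (a p) * \<rho> ^ (fst p + snd p)) has_sum L) UNIV"
      "\<forall>z\<in>square z0 \<rho>. ((\<lambda>p. a p * monomial z0 z p) has_sum f k z) UNIV"
      unfolding series_norm_le_def by blast
    then show "\<exists>q. snd q \<le> M k \<and> ((\<lambda>p. norm (fst q p) * \<rho> ^ (fst p + snd p)) has_sum snd q) UNIV \<and>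
      (\<forall>z\<in>square z0 \<rho>. ((\<lambda>p. fst q p * monomial z0 z p) has_sum f k z) UNIV)"
      by (intro exI[of _ "(a, L)"]) simp
  qed
  from choice[OF this] obtain Q where Q: "\<And>k. snd (Q k) \<le> M k"
    "\<And>k. ((\<lambda>p. norm (fst (Q k) p) * \<rho> ^ (fst p + snd p)) has_sum snd (Q k)) UNIV"
    "\<And>k z. z \<in> square z0 \<rho> \<Longrightarrow> ((\<lambda>p. fst (Q k) p * monomial z0 z p) has_sum f k z) UNIV" by blast
  define a where "a k = fst (Q k)" for k
  define L where "L k = snd (Q k)" for k
  have L: "L k \<le> M k" and w: "((\<lambda>p. norm (a k p) * \<rho> ^ (fst p + snd p)) has_sum L k) UNIV"
    and rep: "\<And>z. z \<in> square z0 \<rho> \<Longrightarrow> ((\<lambda>p. a k p * monomial z0 z p) has_sum f k z) UNIV" for k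
    unfolding a_def L_def by (fact Q)+
  have L0: "0 \<le> L k" for k by (rule has_sum_nonneg[OF w]) (use \<rho> in auto)
  have Ls: "L summable_on UNIV"
    by (rule summable_on_comparison_test[of M]) (use M L L0 in \<open>auto simp: summable_on_def\<close>)
  then obtain S' where S': "(L has_sum S') UNIV" by (auto simp: summable_on_def)
  have "S' \<le> S" by (rule has_sum_mono[OF S' M L])
  let ?W = "\<lambda>i. norm (a (fst i) (snd i)) * \<rho> ^ (fst (snd i) + snd (snd i))"
  have Ws: "?W summable_on UNIV \<times> UNIV"
    by (rule summable_on_SigmaI[where g = L]) (use w Ls \<rho> in auto)
  have W: "(?W has_sum S') (UNIV \<times> UNIV)"
    by (rule has_sum_SigmaI[where g = L]) (use w S' Ws in auto)
  show ?thesis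
  proof (rule series_norm_le_regroup[OF \<rho>, where F = "\<lambda>i. a (fst i) (snd i)" and \<pi> = snd])
    show "(?W has_sum S') UNIV" using W by simp
    show "((\<lambda>i. a (fst i) (snd i) * monomial z0 z (snd i)) has_sum v z) UNIV" if z: "z \<in> square z0 \<rho>" for z
    proof -
      have "(\<lambda>i. a (fst i) (snd i) * monomial z0 z (snd i)) summable_on UNIV \<times> UNIV"
        by (rule summable_on_norm_bound[OF Ws]) (use norm_monomial_le[OF z] in \<open>auto simp: norm_mult intro!: mult_left_mono\<close>)
      then have "((\<lambda>i. a (fst i) (snd i) * monomial z0 z (snd i)) has_sum v z) (UNIV \<times> UNIV)"
        by (intro has_sum_SigmaI[where g = "\<lambda>k. f k z"]) (use rep[OF z] v[OF z] in auto)
      then show ?thesis by simp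
    qed
  qed fact
qed

lemma series_norm_le_mult:
  assumes \<rho>: "0 < \<rho>" and u: "series_norm_le z0 \<rho> u K" and v: "series_norm_le z0 \<rho> v M"
  shows "series_norm_le z0 \<rho> (\<lambda>z. u z * v z) (K * M)"
proof -
  obtain a La where a: "La \<le> K" "((\<lambda>p. norm (a p) * \<rho> ^ (fst p + snd p)) has_sum La) UNIV"
    "\<And>z. z \<in> square z0 \<rho> \<Longrightarrow> ((\<lambda>p. a p * monomial z0 z p) has_sum u z) UNIV"
    using u unfolding series_norm_le_def by blast
  obtain b Lb where b: "Lb \<le> M" "((\<lambda>p. norm (b p) * \<rho> ^ (fst p + snd p)) has_sum Lb) UNIV"
    "\<And>z. z \<in> square z0 \<rho> \<Longrightarrow> ((\<lambda>p. b p * monomial z0 z p) has_sum v z) UNIV"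
    using v unfolding series_norm_le_def by blast
  have L0: "0 \<le> La" "0 \<le> Lb"
    by (rule has_sum_nonneg[OF a(2)], use \<rho> in simp, rule has_sum_nonneg[OF b(2)], use \<rho> in simp)
  let ?wa = "\<lambda>p. norm (a p) * \<rho> ^ (fst p + snd p)" and ?wb = "\<lambda>p. norm (b p) * \<rho> ^ (fst p + snd p)"
  have inner: "((\<lambda>r. ?wa q * ?wb r) has_sum ?wa q * Lb) UNIV" for q by (rule has_sum_cmult_right[OF b(2)])
  have outer: "((\<lambda>q. ?wa q * Lb) has_sum La * Lb) UNIV" by (rule has_sum_cmult_left[OF a(2)])
  have Ws: "(\<lambda>(q, r). ?wa q * ?wb r) summable_on UNIV \<times> UNIV"
    by (rule summable_on_SigmaI[where g = "\<lambda>q. ?wa q * Lb"])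
       (use inner outer \<rho> in \<open>auto simp: summable_on_def\<close>)
  have W: "((\<lambda>(q, r). ?wa q * ?wb r) has_sum La * Lb) (UNIV \<times> UNIV)"
    by (rule has_sum_SigmaI[where g = "\<lambda>q. ?wa q * Lb"]) (use inner outer Ws in auto)
  let ?\<pi> = "\<lambda>i. (fst (fst i) + fst (snd i), snd (fst i) + snd (snd i))"
  let ?F = "\<lambda>i. a (fst i) * b (snd i)"
  have W_eq: "norm (?F i) * \<rho> ^ (fst (?\<pi> i) + snd (?\<pi> i)) = (case i of (q, r) \<Rightarrow> ?wa q * ?wb r)" for i
    by (cases i) (simp add: norm_mult power_add mult_ac)
  have m_eq: "?F i * monomial z0 z (?\<pi> i) = (case i of (q, r) \<Rightarrow> (a q * monomial z0 z q) * (b r * monomial z0 z r))" for i z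
    by (cases i) (simp add: monomial_def power_add mult_ac)
  show ?thesis
  proof (rule series_norm_le_regroup[OF \<rho>, where F = ?F and \<pi> = ?\<pi>])
    show "((\<lambda>i. norm (?F i) * \<rho> ^ (fst (?\<pi> i) + snd (?\<pi> i))) has_sum La * Lb) UNIV"
      unfolding W_eq using W by simp
    show "((\<lambda>i. ?F i * monomial z0 z (?\<pi> i)) has_sum u z * v z) UNIV" if z: "z \<in> square z0 \<rho>" for z
    proof -
      have s: "(\<lambda>(q, r). (a q * monomial z0 z q) * (b r * monomial z0 z r)) summable_on UNIV \<times> UNIV"
        by (rule summable_on_norm_bound[OF Ws])
           (use norm_monomial_le[OF z] \<rho> in \<open>auto simp: norm_mult intro!: mult_mono\<close>)
      have "((\<lambda>(q, r). (a q * monomial z0 z q) * (b r * monomial z0 z r)) has_sum u z * v z) (UNIV \<times> UNIV)"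
        by (rule has_sum_SigmaI[where g = "\<lambda>q. (a q * monomial z0 z q) * v z"])
           (use has_sum_cmult_right[OF b(3)[OF z]] has_sum_cmult_left[OF a(3)[OF z]] s in auto)
      then show ?thesis unfolding m_eq by simp
    qed
    show "La * Lb \<le> K * M" using a(1) b(1) L0 by (intro mult_mono) auto
  qed
qed

lemma series_norm_le_const: "0 < \<rho> \<Longrightarrow> series_norm_le z0 \<rho> (\<lambda>_. c) (norm c)"
  by (rule series_norm_le_regroup[where F = "\<lambda>_::unit. c" and \<pi> = "\<lambda>_. (0, 0)" and L = "norm c"])
     (auto simp: monomial_def intro!: has_sum_finiteI)

lemma series_norm_le_id:
  assumes "0 < \<rho>"
  shows "series_norm_le z0 \<rho> (\<lambda>z. z - z0) (2 * \<rho>)"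
proof (rule series_norm_le_regroup[where F = "\<lambda>b. if b then 1 else \<i>" and \<pi> = "\<lambda>b. if b then (1, 0) else (0, 1)" and L = "2 * \<rho>"])
  show "((\<lambda>b. (if b then 1 else \<i>) * monomial z0 z (if b then (1, 0) else (0, 1))) has_sum z - z0) UNIV" for z
    by (rule has_sum_finiteI) (auto simp: UNIV_bool monomial_def complex_eq_iff)
qed (use assms in \<open>auto simp: UNIV_bool intro!: has_sum_finiteI\<close>)

lemma series_norm_le_power:
  assumes "0 < \<rho>" "series_norm_le z0 \<rho> v M"
  shows "series_norm_le z0 \<rho> (\<lambda>z. v z ^ n) (M ^ n)"
proof (induction n)
  case 0
  show ?case using series_norm_le_const[OF assms(1), of z0 1] by simp
next
  case (Suc n)
  show ?case using series_norm_le_mult[OF assms Suc] by simp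
qed

lemma series_norm_le_mono:
  assumes "series_norm_le z0 \<rho> v M" "M \<le> M'"
  shows "series_norm_le z0 \<rho> v M'"
  using assms unfolding series_norm_le_def by (meson order_trans)

lemma series_norm_le_add:
  assumes "0 < \<rho>" "series_norm_le z0 \<rho> u K" "series_norm_le z0 \<rho> v M"
  shows "series_norm_le z0 \<rho> (\<lambda>z. u z + v z) (K + M)"
proof (rule series_norm_le_infsum[where f = "\<lambda>b. if b then u else v" and M = "\<lambda>b. if b then K else M"])
  show "((\<lambda>b. (if b then u else v) z) has_sum u z + v z) UNIV" for z
    by (rule has_sum_finiteI) (auto simp: UNIV_bool)
  show "((\<lambda>b. if b then K else M) has_sum K + M) UNIV"
    by (rule has_sum_finiteI) (auto simp: UNIV_bool)
qed (use assms in auto)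

lemma series_norm_le_bound:
  assumes "series_norm_le z0 \<rho> v M" "z \<in> square z0 \<rho>"
  shows "norm (v z) \<le> M"
proof -
  obtain a L where a: "L \<le> M" "((\<lambda>p. norm (a p) * \<rho> ^ (fst p + snd p)) has_sum L) UNIV"
    "((\<lambda>p. a p * monomial z0 z p) has_sum v z) UNIV"
    using assms unfolding series_norm_le_def by blast
  have le: "norm (a p * monomial z0 z p) \<le> norm (a p) * \<rho> ^ (fst p + snd p)" for p
    unfolding norm_mult by (intro mult_left_mono norm_monomial_le[OF assms(2)]) auto
  have "(\<lambda>p. norm (a p * monomial z0 z p)) summable_on UNIV"
    by (rule summable_on_comparison_test[where f = "\<lambda>p. norm (a p) * \<rho> ^ (fst p + snd p)"])
       (use a(2) le in \<open>auto simp: summable_on_def\<close>)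
  then obtain L' where L': "((\<lambda>p. norm (a p * monomial z0 z p)) has_sum L') UNIV" by (auto simp: summable_on_def)
  have "norm (v z) \<le> L'" by (rule norm_has_sum_bound[OF L' a(3)])
  also have "L' \<le> L" by (rule has_sum_mono[OF L' a(2) le])
  finally show ?thesis using a(1) by simp
qed

text \<open>
  Without its constant term, every monomial of the series gains at least one factor \<open>t\<close> when the square
  is scaled by \<open>t\<close>. Thus the oscillation of \<open>v\<close> about \<open>z0\<close> can be made small in norm, which gives
  both continuity and the hypothesis of the composition lemma.
\<close>

lemma series_norm_le_shrink:
  assumes \<rho>: "0 < \<rho>" and v: "series_norm_le z0 \<rho> v M" and t: "0 < t" "t \<le> 1"
  shows "series_norm_le z0 (t * \<rho>) (\<lambda>z. v z - v z0) (t * M)"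
proof -
  obtain a L where a: "L \<le> M" "((\<lambda>p. norm (a p) * \<rho> ^ (fst p + snd p)) has_sum L) UNIV"
    "\<And>z. z \<in> square z0 \<rho> \<Longrightarrow> ((\<lambda>p. a p * monomial z0 z p) has_sum v z) UNIV"
    using v unfolding series_norm_le_def by blast
  define a' where "a' p = (if p = (0, 0) then 0 else a p)" for p
  have only0: "((\<lambda>p. if p = (0, 0) then a p else 0) has_sum a (0, 0)) UNIV"
    by (rule has_sum_finite_neutralI[of "{(0, 0)}"]) auto
  have "((\<lambda>p. a p * monomial z0 z0 p) has_sum a (0, 0)) UNIV"
  proof (rule has_sum_cong[THEN iffD2, OF _ only0])
    show "a p * monomial z0 z0 p = (if p = (0, 0) then a p else 0)" for p
      by (cases p) (auto simp: monomial_def power_0_left)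
  qed
  moreover have "((\<lambda>p. a p * monomial z0 z0 p) has_sum v z0) UNIV" by (rule a(3)) (use \<rho> in \<open>simp add: square_def\<close>)
  ultimately have v0: "v z0 = a (0, 0)" using has_sum_unique by blast
  have sub: "square z0 (t * \<rho>) \<subseteq> square z0 \<rho>"
  proof -
    have "t * \<rho> \<le> \<rho>" using mult_right_mono[OF t(2), of \<rho>] \<rho> by simp
    then show ?thesis unfolding square_def by force
  qed
  have rep: "((\<lambda>p. a' p * monomial z0 z p) has_sum v z - v z0) UNIV" if "z \<in> square z0 (t * \<rho>)" for z
  proof -
    have "((\<lambda>p. a p * monomial z0 z p + - (if p = (0, 0) then a p else 0)) has_sum v z + - a (0, 0)) UNIV"
      by (intro has_sum_add a(3) has_sum_uminus[THEN iffD2]) (use that sub only0 in auto)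
    moreover have "a p * monomial z0 z p + - (if p = (0, 0) then a p else 0) = a' p * monomial z0 z p" for p
      by (auto simp: a'_def monomial_def)
    ultimately show ?thesis by (simp add: v0)
  qed
  have le: "norm (a' p) * (t * \<rho>) ^ (fst p + snd p) \<le> t * (norm (a p) * \<rho> ^ (fst p + snd p))" for p
  proof (cases "p = (0, 0)")
    case False
    then obtain k where k: "fst p + snd p = Suc k" by (cases p) (auto simp: gr0_conv_Suc dest: not0_implies_Suc)
    have "t ^ Suc k \<le> t" using power_decreasing[of 1 "Suc k" t] t by simp
    then have "t ^ Suc k * (norm (a p) * \<rho> ^ Suc k) \<le> t * (norm (a p) * \<rho> ^ Suc k)"
      using \<rho> by (intro mult_right_mono) auto
    then show ?thesis using False unfolding k by (simp add: a'_def power_mult_distrib mult_ac)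
  qed (use t \<rho> in \<open>simp add: a'_def\<close>)
  have tL: "((\<lambda>p. t * (norm (a p) * \<rho> ^ (fst p + snd p))) has_sum t * L) UNIV" by (rule has_sum_cmult_right[OF a(2)])
  have "(\<lambda>p. norm (a' p) * (t * \<rho>) ^ (fst p + snd p)) summable_on UNIV"
    by (rule summable_on_comparison_test[of "\<lambda>p. t * (norm (a p) * \<rho> ^ (fst p + snd p))"])
       (use tL le t \<rho> in \<open>auto simp: summable_on_def\<close>)
  then obtain L' where L': "((\<lambda>p. norm (a' p) * (t * \<rho>) ^ (fst p + snd p)) has_sum L') UNIV" by (auto simp: summable_on_def)
  have "L' \<le> t * L" by (rule has_sum_mono[OF L' tL le])
  also have "\<dots> \<le> t * M" using a(1) t by simp
  finally show ?thesis unfolding series_norm_le_def using L' rep by blast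
qed

text \<open>
  Substituting a series of norm at most \<open>s\<close> into the Taylor series of \<open>\<phi>\<close> at \<open>w0\<close>, which converges
  absolutely at radius \<open>s < e\<close>, gives an absolutely convergent sum in the weighted norm.
\<close>

lemma series_norm_le_compose:
  assumes \<rho>: "0 < \<rho>" and u: "series_norm_le z0 \<rho> (\<lambda>z. u z - w0) s" and s: "0 < s" "s < e"
    and \<phi>: "\<phi> holomorphic_on ball w0 e"
  obtains M where "series_norm_le z0 \<rho> (\<lambda>z. \<phi> (u z)) M"
proof -
  define c where "c n = (deriv ^^ n) \<phi> w0 / fact n" for n
  have sums: "(\<lambda>n. c n * (w - w0) ^ n) sums \<phi> w" if "w \<in> ball w0 e" for w
    unfolding c_def by (rule holomorphic_power_series[OF \<phi> that])
  \<comment> \<open>A point strictly between the radii \<open>s\<close> and \<open>e\<close>: convergence there gives absolute convergence at \<open>s\<close>.\<close>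
  define x where "x = complex_of_real ((s + e) / 2)"
  have nx: "norm x = (s + e) / 2" unfolding x_def norm_of_real using s by simp
  have "w0 + x \<in> ball w0 e" using s nx by (simp add: dist_norm)
  from sums[OF this] have "summable (\<lambda>n. c n * x ^ n)" by (simp add: sums_iff)
  then have "summable (\<lambda>n. norm (c n * complex_of_real s ^ n))"
    by (rule powser_insidea) (use s nx in simp)
  then have cs: "summable (\<lambda>n. norm (c n) * s ^ n)" using s by (simp add: norm_mult norm_power)
  then have S: "((\<lambda>n. norm (c n) * s ^ n) has_sum suminf (\<lambda>n. norm (c n) * s ^ n)) UNIV"
    using s by (intro norm_summable_imp_has_sum summable_sums) auto
  have "series_norm_le z0 \<rho> (\<lambda>z. \<phi> (u z)) (suminf (\<lambda>n. norm (c n) * s ^ n))"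
  proof (rule series_norm_le_infsum[OF \<rho> _ S])
    show "series_norm_le z0 \<rho> (\<lambda>z. c n * (u z - w0) ^ n) (norm (c n) * s ^ n)" for n
      by (intro series_norm_le_mult series_norm_le_const series_norm_le_power \<rho> u)
    show "((\<lambda>n. c n * (u z - w0) ^ n) has_sum \<phi> (u z)) UNIV" if z: "z \<in> square z0 \<rho>" for z
    proof (rule norm_summable_imp_has_sum)
      have le: "norm (u z - w0) \<le> s" using series_norm_le_bound[OF u z] .
      then show "(\<lambda>n. c n * (u z - w0) ^ n) sums \<phi> (u z)"
        using s by (intro sums) (simp add: dist_norm norm_minus_commute)
      show "summable (\<lambda>n. norm (c n * (u z - w0) ^ n))"
        by (rule summable_comparison_test'[OF cs, of 0])
           (use le in \<open>auto simp: norm_mult norm_power intro!: mult_left_mono power_mono\<close>)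
    qed
  qed
  then show thesis by (rule that)
qed

definition analytic2_at :: "(complex \<Rightarrow> complex) \<Rightarrow> complex \<Rightarrow> bool" where
  "analytic2_at v z0 \<longleftrightarrow> (\<exists>\<rho>>0. \<exists>M. series_norm_le z0 \<rho> v M)"

lemma ball_subset_square: "ball z0 \<rho> \<subseteq> square z0 \<rho>"
proof
  fix z assume "z \<in> ball z0 \<rho>"
  then have "norm (z - z0) < \<rho>" by (simp add: dist_norm norm_minus_commute)
  then show "z \<in> square z0 \<rho>" using abs_Re_le_cmod[of "z - z0"] abs_Im_le_cmod[of "z - z0"] by (simp add: square_def)
qed

lemma square_subset_ball:
  assumes "0 < e"
  shows "square z0 (e / 3) \<subseteq> ball z0 e"
proof
  fix z assume "z \<in> square z0 (e / 3)"
  then have "norm (z - z0) \<le> e / 3 + e / 3" using cmod_le[of "z - z0"] by (simp add: square_def)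
  also have "\<dots> < e" using assms by simp
  finally show "z \<in> ball z0 e" by (simp add: dist_norm norm_minus_commute)
qed

lemma double_series_eq_monomials:
  "(\<lambda>(m, n). a (m, n) * of_real (Re z - Re z0) ^ m * of_real (Im z - Im z0) ^ n) = (\<lambda>p. a p * monomial z0 z p)"
  by (auto simp: monomial_def fun_eq_iff mult.assoc)

lemma real_analytic_on2_iff:
  assumes "open S"
  shows "real_analytic_on2 S v \<longleftrightarrow> (\<forall>z0\<in>S. analytic2_at v z0)"
proof (intro iffI ballI)
  fix z0 assume "real_analytic_on2 S v" "z0 \<in> S"
  then obtain e a where e: "e > 0" and
    a: "\<And>z. z \<in> ball z0 e \<Longrightarrow> ((\<lambda>(m, n). a (m, n) * of_real (Re z - Re z0) ^ m * of_real (Im z - Im z0) ^ n) has_sum v z) UNIV"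
    unfolding real_analytic_on2_def by blast
  have a': "((\<lambda>p. a p * monomial z0 z p) has_sum v z) UNIV" if "z \<in> ball z0 e" for z
    using a[OF that] unfolding double_series_eq_monomials .
  define \<rho> where "\<rho> = e / 3"
  have \<rho>: "\<rho> > 0" using e by (simp add: \<rho>_def)
  have sub: "square z0 \<rho> \<subseteq> ball z0 e" unfolding \<rho>_def by (rule square_subset_ball[OF e])
  \<comment> \<open>Convergence at the corner of the square is unconditional, hence absolute, and yields the weighted norm.\<close>
  define w where "w = z0 + Complex \<rho> \<rho>"
  have "w \<in> square z0 \<rho>" using \<rho> by (simp add: w_def square_def)
  then have "((\<lambda>p. a p * monomial z0 w p) has_sum v w) UNIV" using a' sub by blast
  then have "(\<lambda>p. a p * monomial z0 w p) summable_on UNIV" unfolding summable_on_def by blast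
  then have "(\<lambda>p. norm (a p * monomial z0 w p)) summable_on UNIV"
    by (simp only: summable_on_iff_abs_summable_on_complex)
  moreover have "norm (a p * monomial z0 w p) = norm (a p) * \<rho> ^ (fst p + snd p)" for p
    using \<rho> by (simp add: monomial_def w_def norm_mult norm_power power_add)
  ultimately obtain L where "((\<lambda>p. norm (a p) * \<rho> ^ (fst p + snd p)) has_sum L) UNIV" by (auto simp: summable_on_def)
  then have "series_norm_le z0 \<rho> v L" unfolding series_norm_le_def using a' sub by blast
  then show "analytic2_at v z0" unfolding analytic2_at_def using \<rho> by blast
next
  assume *: "\<forall>z0\<in>S. analytic2_at v z0"
  show "real_analytic_on2 S v"
    unfolding real_analytic_on2_def
  proof
    fix z0 assume "z0 \<in> S"
    then obtain \<rho> M a L where "\<rho> > 0" and a: "\<And>z. z \<in> square z0 \<rho> \<Longrightarrow> ((\<lambda>p. a p * monomial z0 z p) has_sum v z) UNIV"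
      using * unfolding analytic2_at_def series_norm_le_def by meson
    have "((\<lambda>(m, n). a (m, n) * of_real (Re z - Re z0) ^ m * of_real (Im z - Im z0) ^ n) has_sum v z) UNIV" if "z \<in> ball z0 \<rho>" for z
    proof -
      have "z \<in> square z0 \<rho>" using that ball_subset_square by blast
      from a[OF this] show ?thesis unfolding double_series_eq_monomials .
    qed
    with \<open>\<rho> > 0\<close> show "\<exists>\<epsilon>>0. \<exists>a. \<forall>z\<in>ball z0 \<epsilon>. ((\<lambda>(m, n). a (m, n) * of_real (Re z - Re z0) ^ m * of_real (Im z - Im z0) ^ n) has_sum v z) UNIV"
      by blast
  qed
qed


lemma analytic2_at_small_squares:
  assumes "analytic2_at v z0"
  obtains \<rho>0 where "\<rho>0 > 0" "\<And>\<rho>. 0 < \<rho> \<Longrightarrow> \<rho> \<le> \<rho>0 \<Longrightarrow> \<exists>M. series_norm_le z0 \<rho> v M"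
proof -
  obtain \<rho>0 M where v: "\<rho>0 > 0" "series_norm_le z0 \<rho>0 v M" using assms unfolding analytic2_at_def by blast
  have "\<exists>M. series_norm_le z0 \<rho> v M" if "0 < \<rho>" "\<rho> \<le> \<rho>0" for \<rho>
  proof -
    have "0 < \<rho> / \<rho>0" "\<rho> / \<rho>0 \<le> 1" using that by auto
    from series_norm_le_shrink[OF v this]
    have "series_norm_le z0 \<rho> (\<lambda>z. v z - v z0) (\<rho> / \<rho>0 * M)" using v(1) by simp
    from series_norm_le_add[OF that(1) this series_norm_le_const[OF that(1)], of "v z0"]
    show ?thesis by auto
  qed
  with v(1) show thesis by (rule that)
qed

lemma analytic2_at_oscillation:
  assumes "analytic2_at u z0" "0 < s"
  obtains \<rho> where "0 < \<rho>" "series_norm_le z0 \<rho> (\<lambda>z. u z - u z0) s"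
proof -
  obtain \<rho> M where u: "\<rho> > 0" "series_norm_le z0 \<rho> u M" using assms(1) unfolding analytic2_at_def by blast
  define t where "t = min 1 (s / (\<bar>M\<bar> + 1))"
  have t: "0 < t" "t \<le> 1" using assms(2) by (auto simp: t_def)
  have "t * M \<le> s / (\<bar>M\<bar> + 1) * (\<bar>M\<bar> + 1)"
    using assms(2) by (intro order.trans[OF mult_left_mono[of M "\<bar>M\<bar> + 1"] mult_right_mono]) (use t in \<open>auto simp: t_def\<close>)
  then have "t * M \<le> s" by simp
  from series_norm_le_mono[OF series_norm_le_shrink[OF u t] this] t u(1) show thesis
    by (intro that[of "t * \<rho>"]) auto
qed

lemma analytic2_at_add:
  assumes "analytic2_at u z0" "analytic2_at v z0"
  shows "analytic2_at (\<lambda>z. u z + v z) z0"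
proof -
  obtain \<rho>1 where 1: "\<rho>1 > 0" "\<And>\<rho>. 0 < \<rho> \<Longrightarrow> \<rho> \<le> \<rho>1 \<Longrightarrow> \<exists>M. series_norm_le z0 \<rho> u M"
    using analytic2_at_small_squares[OF assms(1)] by blast
  obtain \<rho>2 where 2: "\<rho>2 > 0" "\<And>\<rho>. 0 < \<rho> \<Longrightarrow> \<rho> \<le> \<rho>2 \<Longrightarrow> \<exists>M. series_norm_le z0 \<rho> v M"
    using analytic2_at_small_squares[OF assms(2)] by blast
  define \<rho> where "\<rho> = min \<rho>1 \<rho>2"
  have \<rho>: "0 < \<rho>" "\<rho> \<le> \<rho>1" "\<rho> \<le> \<rho>2" using 1(1) 2(1) by (auto simp: \<rho>_def)
  obtain K M where "series_norm_le z0 \<rho> u K" "series_norm_le z0 \<rho> v M" using 1(2)[OF \<rho>(1,2)] 2(2)[OF \<rho>(1,3)] by blast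
  from series_norm_le_add[OF \<rho>(1) this] \<rho>(1) show ?thesis unfolding analytic2_at_def by blast
qed

lemma analytic2_at_id: "analytic2_at (\<lambda>z. z) z0"
proof -
  have "series_norm_le z0 1 (\<lambda>z. z - z0 + z0) (2 * 1 + norm z0)"
    by (intro series_norm_le_add series_norm_le_id series_norm_le_const) auto
  then show ?thesis unfolding analytic2_at_def by (intro exI[of _ 1]) auto
qed

lemma analytic2_at_compose:
  assumes u: "analytic2_at u z0" and T: "open T" "u z0 \<in> T" and \<phi>: "\<phi> holomorphic_on T"
  shows "analytic2_at (\<lambda>z. \<phi> (u z)) z0"
proof -
  obtain e where e: "e > 0" "ball (u z0) e \<subseteq> T" using openE[OF T] .
  obtain \<rho> where \<rho>: "0 < \<rho>" "series_norm_le z0 \<rho> (\<lambda>z. u z - u z0) (e / 2)"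
    using analytic2_at_oscillation[OF u, of "e / 2"] e by auto
  obtain M where "series_norm_le z0 \<rho> (\<lambda>z. \<phi> (u z)) M"
    by (rule series_norm_le_compose[OF \<rho> _ _ holomorphic_on_subset[OF \<phi> e(2)]]) (use e in auto)
  then show ?thesis unfolding analytic2_at_def using \<rho>(1) by blast
qed

lemma analytic2_at_cong:
  assumes u: "analytic2_at u z0" and W: "open W" "z0 \<in> W" and eq: "\<And>z. z \<in> W \<Longrightarrow> u z = v z"
  shows "analytic2_at v z0"
proof -
  obtain \<rho>1 where 1: "\<rho>1 > 0" "\<And>\<rho>. 0 < \<rho> \<Longrightarrow> \<rho> \<le> \<rho>1 \<Longrightarrow> \<exists>M. series_norm_le z0 \<rho> u M"
    using analytic2_at_small_squares[OF u] by blast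
  obtain e where e: "e > 0" "ball z0 e \<subseteq> W" using openE[OF W] .
  define e' where "e' = min e (3 * \<rho>1)"
  have e': "e' > 0" "ball z0 e' \<subseteq> W" "e' / 3 \<le> \<rho>1" using e 1(1) by (auto simp: e'_def)
  obtain M where M: "series_norm_le z0 (e' / 3) u M" using 1(2)[of "e' / 3"] e' by auto
  have "u z = v z" if "z \<in> square z0 (e' / 3)" for z
    using eq square_subset_ball[OF e'(1)] e'(2) that by blast
  with M have "series_norm_le z0 (e' / 3) v M" unfolding series_norm_le_def by simp
  then show ?thesis unfolding analytic2_at_def using e'(1) by (intro exI[of _ "e' / 3"]) auto
qed

lemma analytic2_at_imp_isCont:
  assumes "analytic2_at u z0"
  shows "isCont u z0"
  unfolding continuous_at_eps_delta
proof (intro allI impI)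
  fix e :: real assume e: "e > 0"
  obtain \<rho> where \<rho>: "0 < \<rho>" "series_norm_le z0 \<rho> (\<lambda>z. u z - u z0) (e / 2)"
    using analytic2_at_oscillation[OF assms, of "e / 2"] e by auto
  have "dist (u z) (u z0) < e" if "dist z z0 < \<rho>" for z
  proof -
    have "z \<in> square z0 \<rho>" using that ball_subset_square[of z0 \<rho>] by (auto simp: dist_commute)
    from series_norm_le_bound[OF \<rho>(2) this] show ?thesis using e by (simp add: dist_norm)
  qed
  then show "\<exists>d>0. \<forall>x'. dist x' z0 < d \<longrightarrow> dist (u x') (u z0) < e" using \<rho>(1) by blast
qed

section \<open>Regularity of solutions\<close>

text \<open>
  The derivative \<open>1 / f w0\<close> of a primitive is not 0, so the primitive is injective near \<open>w0\<close> and has a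
  holomorphic inverse there.
\<close>

lemma local_primitive_of_reciprocal:
  assumes \<Omega>: "open \<Omega>" "w0 \<in> \<Omega>" and f: "f holomorphic_on \<Omega>" "f w0 \<noteq> 0"
  obtains V \<Phi> \<Psi> where "open V" "w0 \<in> V" "V \<subseteq> \<Omega>" "\<And>w. w \<in> V \<Longrightarrow> f w \<noteq> 0"
    "\<And>w. w \<in> V \<Longrightarrow> (\<Phi> has_field_derivative 1 / f w) (at w)"
    "open (\<Phi> ` V)" "\<Psi> holomorphic_on \<Phi> ` V" "\<And>w. w \<in> V \<Longrightarrow> \<Psi> (\<Phi> w) = w"
proof -
  have "open {w \<in> \<Omega>. f w \<noteq> 0}"
    using open_nonvanishing_set[of \<Omega> \<Omega> f "\<lambda>w. w"] \<Omega> f by auto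
  moreover have "w0 \<in> {w \<in> \<Omega>. f w \<noteq> 0}" using \<Omega> f by simp
  ultimately obtain e where e: "e > 0" "ball w0 e \<subseteq> {w \<in> \<Omega>. f w \<noteq> 0}" by (rule openE)
  have hol: "(\<lambda>w. 1 / f w) holomorphic_on ball w0 e"
    by (intro holomorphic_intros holomorphic_on_subset[OF f(1)]) (use e in auto)
  obtain \<Phi> where \<Phi>_within: "\<And>w. w \<in> ball w0 e \<Longrightarrow> (\<Phi> has_field_derivative 1 / f w) (at w within ball w0 e)"
    using holomorphic_convex_primitive'[OF convex_ball open_ball hol] by blast
  have \<Phi>: "(\<Phi> has_field_derivative 1 / f w) (at w)" if "w \<in> ball w0 e" for w
    using \<Phi>_within[OF that] by (simp add: at_within_open[OF that open_ball])
  have \<Phi>_hol: "\<Phi> holomorphic_on ball w0 e"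
    unfolding holomorphic_on_def field_differentiable_def using \<Phi> has_field_derivative_at_within by blast
  have "deriv \<Phi> w0 \<noteq> 0" using DERIV_imp_deriv[OF \<Phi>[of w0]] e f(2) by simp
  then obtain r where r: "r > 0" "ball w0 r \<subseteq> ball w0 e" "inj_on \<Phi> (ball w0 r)"
    using has_complex_derivative_locally_injective[OF \<Phi>_hol _ open_ball, of w0] e(1) by auto
  have \<Phi>_hol': "\<Phi> holomorphic_on ball w0 r" using \<Phi>_hol r(2) by (rule holomorphic_on_subset)
  obtain \<Psi> where \<Psi>: "\<Psi> holomorphic_on \<Phi> ` ball w0 r"
    "\<And>w. w \<in> ball w0 r \<Longrightarrow> deriv \<Phi> w * deriv \<Psi> (\<Phi> w) = 1" "\<And>w. w \<in> ball w0 r \<Longrightarrow> \<Psi> (\<Phi> w) = w"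
    by (rule holomorphic_has_inverse[OF \<Phi>_hol' open_ball r(3)]) (rule that)
  have "open (\<Phi> ` ball w0 r)" by (rule open_mapping_thm3[OF \<Phi>_hol' open_ball r(3)])
  show thesis
  proof (rule that[of "ball w0 r" \<Phi> \<Psi>])
    have "ball w0 r \<subseteq> {w \<in> \<Omega>. f w \<noteq> 0}" using r(2) e(2) by (rule order.trans)
    then show "ball w0 r \<subseteq> \<Omega>" "\<And>w. w \<in> ball w0 r \<Longrightarrow> f w \<noteq> 0" by blast+
    show "(\<Phi> has_field_derivative 1 / f w) (at w)" if "w \<in> ball w0 r" for w
      using \<Phi> r(2) that by blast
  qed (use r(1) \<Psi> \<open>open (\<Phi> ` ball w0 r)\<close> in auto)
qed

text \<open>
  The function \<open>h\<close> is \<open>\<Phi> \<circ> v - G\<close>. The equation for \<open>v\<close> says exactly that \<open>dbar h = 0\<close>, so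
  \<open>h\<close> is holomorphic by the Looman-Menchoff theorem.
\<close>

lemma solution_local_form:
  assumes \<Omega>: "open \<Omega>1" "open \<Omega>2" and f: "f holomorphic_on \<Omega>2"
    and G: "continuous_on \<Omega>1 G" "\<forall>z\<in>\<Omega>1. partials_exist G z \<and> g z = dbar G z"
    and v: "continuous_on \<Omega>1 v" "v ` \<Omega>1 \<subseteq> \<Omega>2" and \<Omega>0: "\<Omega>0 = {z\<in>\<Omega>1. f (v z) \<noteq> 0}"
    and bad: "countable {z\<in>\<Omega>0. \<not> partials_exist v z}"
    and ae: "AE z in lebesgue. z \<in> \<Omega>0 \<longrightarrow> partials_exist v z \<and> dbar v z = f (v z) * g z"
    and z0: "z0 \<in> \<Omega>0"
  obtains W T h \<Psi> where "open W" "z0 \<in> W" "W \<subseteq> \<Omega>0" "h holomorphic_on W"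
    "open T" "\<Psi> holomorphic_on T" "\<And>z. z \<in> W \<Longrightarrow> G z + h z \<in> T" "\<And>z. z \<in> W \<Longrightarrow> v z = \<Psi> (G z + h z)"
proof -
  have O0: "open \<Omega>0" unfolding \<Omega>0 by (rule open_nonvanishing_set[OF \<Omega> f v])
  have z01: "z0 \<in> \<Omega>1" "f (v z0) \<noteq> 0" "v z0 \<in> \<Omega>2" using z0 v(2) by (auto simp: \<Omega>0)
  obtain V \<Phi> \<Psi> where V: "open V" "v z0 \<in> V" "V \<subseteq> \<Omega>2" "\<And>w. w \<in> V \<Longrightarrow> f w \<noteq> 0"
    "\<And>w. w \<in> V \<Longrightarrow> (\<Phi> has_field_derivative 1 / f w) (at w)"
    "open (\<Phi> ` V)" "\<Psi> holomorphic_on \<Phi> ` V" "\<And>w. w \<in> V \<Longrightarrow> \<Psi> (\<Phi> w) = w"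
    using local_primitive_of_reciprocal[OF \<Omega>(2) z01(3) f z01(2)] by blast
  define W where "W = \<Omega>0 \<inter> v -` V"
  have sub: "W \<subseteq> \<Omega>0" "W \<subseteq> \<Omega>1" by (auto simp: W_def \<Omega>0)
  have "continuous_on \<Omega>0 v" by (rule continuous_on_subset[OF v(1)]) (auto simp: \<Omega>0)
  then have W: "open W" unfolding W_def using O0 V(1) by (rule continuous_open_preimage)
  have vW: "v z \<in> V" if "z \<in> W" for z using that by (simp add: W_def)
  define h where "h z = \<Phi> (v z) - G z" for z
  have h_partials: "has_dx h (1 / f (v z) * dx v z - dx G z) z" "has_dy h (1 / f (v z) * dy v z - dy G z) z"
    if z: "z \<in> W" "partials_exist v z" for z
  proof -
    have Gz: "partials_exist G z" using G(2) z(1) sub by blast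
    show "has_dx h (1 / f (v z) * dx v z - dx G z) z" "has_dy h (1 / f (v z) * dy v z - dy G z) z"
      using partials_compose[OF z(2) V(5)[OF vW[OF z(1)]]] Gz
      unfolding partials_exist_iff has_dx_def has_dy_def h_def by (auto intro: has_vector_derivative_diff)
  qed
  have "h holomorphic_on W"
  proof (rule looman_menchoff[OF W])
    have "continuous_on V \<Phi>" by (auto intro!: continuous_at_imp_continuous_on DERIV_isCont[OF V(5)])
    then have "continuous_on W (\<lambda>z. \<Phi> (v z))"
      by (rule continuous_on_compose2) (use continuous_on_subset[OF v(1) sub(2)] vW in auto)
    then show "continuous_on W h"
      unfolding h_def using continuous_on_subset[OF G(1) sub(2)] by (rule continuous_on_diff)
    have "{z \<in> W. \<not> partials_exist h z} \<subseteq> {z\<in>\<Omega>0. \<not> partials_exist v z}"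
      using h_partials sub unfolding partials_exist_def by blast
    then show "countable {z \<in> W. \<not> partials_exist h z}" using bad by (rule countable_subset)
    show "AE z in lebesgue. z \<in> W \<longrightarrow> dbar h z = 0"
      using ae
    proof (eventually_elim, intro impI)
      fix z assume z: "z \<in> \<Omega>0 \<longrightarrow> partials_exist v z \<and> dbar v z = f (v z) * g z" "z \<in> W"
      then have vz: "partials_exist v z" "dbar v z = f (v z) * g z" and gz: "g z = dbar G z" using sub G(2) by auto
      have "dbar h z = 1 / f (v z) * dbar v z - dbar G z"
        unfolding dbar_def has_dx_imp_dx[OF h_partials(1)[OF z(2) vz(1)]] has_dy_imp_dy[OF h_partials(2)[OF z(2) vz(1)]]
        by (simp add: algebra_simps add_divide_distrib diff_divide_distrib)
      then show "dbar h z = 0" using vz(2) gz V(4)[OF vW[OF z(2)]] by simp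
    qed
  qed
  moreover have "z0 \<in> W" using z0 V(2) by (simp add: W_def)
  ultimately show thesis
    using W sub(1) V(6,7) vW V(8) by (intro that[of W h "\<Phi> ` V" \<Psi>]) (auto simp: h_def)
qed

lemma Cr_on_imp_continuous_on:
  assumes "open S" "Cr_on r S v"
  shows "continuous_on S v"
proof (cases r)
  case (Finite_Order k)
  then show ?thesis using assms(2) Ck_on_imp_continuous_on by simp
next
  case Smooth
  then have "Ck_on 0 S v" using assms(2) by (simp del: Ck_on.simps)
  then show ?thesis by simp
next
  case Real_Analytic
  then show ?thesis using assms real_analytic_on2_iff analytic2_at_imp_isCont
    by (auto intro!: continuous_at_imp_continuous_on)
qed

theorem theorem4p3:
  fixes \<Omega>0 \<Omega>1 \<Omega>2 :: "complex set"
    and f g G v :: "complex \<Rightarrow> complex"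
    and r :: regularity
  assumes "open \<Omega>1" and "open \<Omega>2"
    and "f holomorphic_on \<Omega>2"
    and "Cr_on r \<Omega>1 G"
    and "\<forall>z\<in>\<Omega>1. partials_exist G z \<and> g z = dbar G z"
    and "continuous_on \<Omega>1 v" and "v ` \<Omega>1 \<subseteq> \<Omega>2"
    and "\<Omega>0 = {z\<in>\<Omega>1. f (v z) \<noteq> 0}"
    and "partials_exist_but_countable v \<Omega>0"
    and "AE z in lebesgue. z \<in> \<Omega>0 \<longrightarrow> partials_exist v z \<and> dbar v z = f (v z) * g z"
  shows "Cr_on r \<Omega>0 v"
proof -
  have G: "continuous_on \<Omega>1 G" by (rule Cr_on_imp_continuous_on[OF assms(1,4)])
  have bad: "countable {z\<in>\<Omega>0. \<not> partials_exist v z}" using assms(9) by (simp add: partials_exist_but_countable_def)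
  have O0: "open \<Omega>0" unfolding assms(8) by (rule open_nonvanishing_set) fact+
  have sub01: "\<Omega>0 \<subseteq> \<Omega>1" using assms(8) by auto
  note form = solution_local_form[OF assms(1-3) G assms(5-8) bad assms(10)]
  have finite_order: "Ck_on k \<Omega>0 v" if Gk: "Ck_on k \<Omega>1 G" for k
  proof (rule Ck_on_local)
    fix z0 assume z0: "z0 \<in> \<Omega>0"
    obtain W T h \<Psi> where W: "open W" "z0 \<in> W" "W \<subseteq> \<Omega>0" "h holomorphic_on W"
      and T: "open T" "\<Psi> holomorphic_on T" "\<And>z. z \<in> W \<Longrightarrow> G z + h z \<in> T"
      and v: "\<And>z. z \<in> W \<Longrightarrow> v z = \<Psi> (G z + h z)" by (rule form[OF z0]) (rule that)
    have "Ck_on k W h" using Ck_on_compose_holomorphic[OF W(1) W(1) _ W(4) Ck_on_id] by simp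
    moreover have "Ck_on k W G" using Ck_on_subset[OF Gk] W(3) sub01 by blast
    ultimately have sum: "Ck_on k W (\<lambda>z. G z + h z)" by (intro Ck_on_add W(1))
    have "(\<lambda>z. G z + h z) ` W \<subseteq> T" using T(3) by auto
    from Ck_on_compose_holomorphic[OF W(1) T(1) this T(2) sum]
    have "Ck_on k W v" using Ck_on_cong[OF W(1) v] by simp
    then show "\<exists>T. open T \<and> z0 \<in> T \<and> Ck_on k T v" using W by blast
  qed
  show ?thesis
  proof (cases r)
    case (Finite_Order k)
    then show ?thesis using finite_order assms(4) by simp
  next
    case Smooth
    then show ?thesis using finite_order assms(4) by simp
  next
    case Real_Analytic
    then have Gan: "\<forall>z\<in>\<Omega>1. analytic2_at G z" using assms(1,4) real_analytic_on2_iff by simp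
    have "analytic2_at v z0" if z0: "z0 \<in> \<Omega>0" for z0
    proof -
      obtain W T h \<Psi> where W: "open W" "z0 \<in> W" "W \<subseteq> \<Omega>0" "h holomorphic_on W"
        and T: "open T" "\<Psi> holomorphic_on T" "\<And>z. z \<in> W \<Longrightarrow> G z + h z \<in> T"
        and v: "\<And>z. z \<in> W \<Longrightarrow> v z = \<Psi> (G z + h z)" by (rule form[OF z0]) (rule that)
      have "analytic2_at h z0" using analytic2_at_compose[OF analytic2_at_id W(1,2,4)] .
      moreover have "analytic2_at G z0" using Gan z0 sub01 by blast
      ultimately have "analytic2_at (\<lambda>z. G z + h z) z0" by (intro analytic2_at_add)
      from analytic2_at_compose[OF this T(1) T(3)[OF W(2)] T(2)]
      show ?thesis by (rule analytic2_at_cong[OF _ W(1,2)]) (simp add: v)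
    qed
    then show ?thesis using Real_Analytic real_analytic_on2_iff[OF O0] by simp
  qed
qed

end
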